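(* Let $(\dot g_1,\dot\varphi_1)$ and $(\dot g_2,\dot\varphi_2)$ be elements of $T_{(g,\varphi)}Q$ and denote by $\Phi_1$ and $\Phi_2$ the solutions of the Neumann problem associated to $(g,\dot g_1)$ and $(g,\dot g_2)$, respectively. Let $\mu\in\mathfrak{X}_{\mathrm{vol}}^*$ and let $\alpha$ be the one-form on $\mathcal{F}=\varphi(\mathcal{F}_0)$ such that $\mu=[\varphi^*\alpha]$ and $\alpha=\mathbf{u}_{\mathrm v}^\flat$ for a divergence-free vector field $\mathbf{u}_{\mathrm v}$ on $\mathcal{F}$ tangent to $\partial\mathcal{F}$. Then the $\mu$-component of the curvature $\mathcal{B}$ of the Neumann connection is given by $$\big\langle\mu,\mathcal{B}_{(g,\varphi)}((\dot g_1,\dot\varphi_1),(\dot g_2,\dot\varphi_2))\big\rangle=\langle\!\langle\mathbf{d}\alpha,\mathbf{d}\Phi_1\wedge\mathbf{d}\Phi_2\rangle\!\rangle_{\mathcal{F}}-\int_{\partial\mathcal{F}}\alpha\wedge\ast(\mathbf{d}\Phi_1\wedge\mathbf{d}\Phi_2),$$ where $\langle\!\langle\cdot,\cdot\rangle\!\rangle_{\mathcal{F}}$ is the $L^2$ inner product on forms on $\mathcal{F}$ induced by the Euclidean metric.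
   Context: Body and fluid. $\mathcal{B}_0\subset\mathbb{R}^2$ is a closed disc centred at the origin, $\mathcal{F}_0$ the closure of $\mathbb{R}^2\setminus\mathcal{B}_0$ and $\eta_0$ its Euclidean area form. $g\in SE(2)$ is given by an angle $\beta$ and a vector $\mathbf{x}_0$ and acts by $\mathbf{x}\mapsto R_\beta\mathbf{x}+\mathbf{x}_0$. $Q$ is the (formal infinite-dimensional) manifold of pairs $(g,\varphi)$ with $g\in SE(2)$ and $\varphi:\mathcal{F}_0\to\mathbb{R}^2$ an embedding with $\varphi^*(dx\wedge dy)=\eta_0$, tending to the identity suitably fast at infinity, and $\varphi(\partial\mathcal{F}_0)=g(\partial\mathcal{B}_0)$. $\mathrm{Diff}_{\mathrm{vol}}(\mathcal{F}_0)$ (area-preserving diffeomorphisms) acts on the right by $(g,\varphi)\cdot\phi=(g,\varphi\circ\phi)$, making $Q\to SE(2)$ a principal bundle; its Lie algebra $\mathfrak{X}_{\mathrm{vol}}$ consists of the divergence-free vector fields on $\mathcal{F}_0$ tangent to $\partial\mathcal{F}_0$. All functional-analytic questions are disregarded; fields are assumed smooth and decaying suitably at infinity. Neumann connection. The Neumann problem associated to $(g,\dot g)$, $\dot g=(\dot\beta,\dot{\mathbf{x}}_0)$, is $\nabla^2\Phi=0$ in $\mathcal{F}=\varphi(\mathcal{F}_0)$, $\partial\Phi/\partial n=(\dot\beta\,\mathbf{e}_3\times(\mathbf{x}-\mathbf{x}_0)+\dot{\mathbf{x}}_0)\cdot\mathbf{n}$ on $\partial\mathcal{F}$, $\Phi\to0$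 at infinity. For $(\dot g,\dot\varphi)\in T_{(g,\varphi)}Q$ put $\mathbf{u}=\dot\varphi\circ\varphi^{-1}=\nabla\Phi+\mathbf{u}_{\mathrm v}$ (Helmholtz-Hodge decomposition) with $\mathbf{u}_{\mathrm v}$ divergence free and tangent to $\partial\mathcal{F}$. The connection one-form is $\mathcal{A}_{(g,\varphi)}(\dot g,\dot\varphi)=\varphi^*\mathbf{u}_{\mathrm v}$; horizontal vectors are those with $\dot\varphi=\nabla\Phi\circ\varphi$. The curvature is $\mathcal{B}(U,V)=-\mathcal{A}([X^H,Y^H])$, where $X^H,Y^H$ are the horizontal parts of vector fields on $Q$ extending $U,V$ and the bracket is the usual bracket of vector fields on $Q$. Dual. $\mathfrak{X}_{\mathrm{vol}}^*=\Omega^1(\mathcal{F}_0)/\mathbf{d}\Omega^0(\mathcal{F}_0)$ with pairing $\langle[\gamma],\mathbf{u}\rangle=\int_{\mathcal{F}_0}\gamma(\mathbf{u})\,\eta_0$. $\partial\mathcal{F}$ carries the Stokes boundary orientation of $\mathcal{F}$ and $\ast$ is the Hodge star. *)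

theory Defs
  imports "HOL-Analysis.Analysis"
begin

text \<open>
  The plane is the type \<^typ>\<open>complex\<close>, with \<^term>\<open>x \<bullet> y\<close> the Euclidean inner product and
  \<^term>\<open>lborel\<close> the Euclidean area; multiplication by \<^term>\<open>cis \<beta>\<close> is the rotation \<open>R\<^sub>\<beta>\<close> and
  multiplication by \<^term>\<open>\<i>\<close> is \<open>e\<^sub>3 \<times> _\<close>.
\<close>

section \<open>Smooth fields on closed domains\<close>

text \<open>
  Derivatives are taken within \<open>S\<close>.  The sets used below are closures of smooth open
  sets, or the product of a line with such a set; derivatives within them are unique, also at
  boundary points, and smoothness means smoothness up to the boundary.
\<close>

primrec iter_deriv ::
  "'a::real_normed_vector set \<Rightarrow> 'a list \<Rightarrow> ('a \<Rightarrow> 'b::real_normed_vector) \<Rightarrow> 'a \<Rightarrow> 'b" where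
  "iter_deriv S [] f = f"
| "iter_deriv S (v # vs) f = iter_deriv S vs (\<lambda>x. frechet_derivative f (at x within S) v)"

definition smooth_on ::
  "'a::real_normed_vector set \<Rightarrow> ('a \<Rightarrow> 'b::real_normed_vector) \<Rightarrow> bool" where
  "smooth_on S f \<longleftrightarrow> (\<forall>vs. iter_deriv S vs f differentiable_on S)"

text \<open>
  ``Smooth and decaying suitably at infinity'' is rendered as: the field and all its iterated
  partial derivatives are \<open>O(|x|^-k)\<close>.  Velocity fields (and displacements \<open>\<phi> - id\<close>) use
  \<open>k = 2\<close>, the rate of the potential flows \<open>\<nabla>\<Phi>\<close>.  One-forms, being dual to velocity fields,
  only need \<open>k = 1\<close>: the pairing then converges absolutely and annihilates exact forms, and
  flows with non-zero circulation at infinity are admitted as momenta.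
\<close>

definition smooth_decaying ::
  "nat \<Rightarrow> 'a::real_normed_vector set \<Rightarrow> ('a \<Rightarrow> 'b::real_normed_vector) \<Rightarrow> bool" where
  "smooth_decaying k S f \<longleftrightarrow> smooth_on S f \<and>
     (\<forall>vs. \<exists>C. \<forall>x\<in>S. norm (iter_deriv S vs f x) \<le> C / (1 + norm x) ^ k)"

definition grad :: "complex set \<Rightarrow> (complex \<Rightarrow> real) \<Rightarrow> complex \<Rightarrow> complex" where
  "grad S f x = Complex (frechet_derivative f (at x within S) 1)
                        (frechet_derivative f (at x within S) \<i>)"

definition laplacian :: "complex set \<Rightarrow> (complex \<Rightarrow> real) \<Rightarrow> complex \<Rightarrow> real" where
  "laplacian S f x = iter_deriv S [1, 1] f x + iter_deriv S [\<i>, \<i>] f x"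

definition divergence :: "complex set \<Rightarrow> (complex \<Rightarrow> complex) \<Rightarrow> complex \<Rightarrow> real" where
  "divergence S u x = Re (frechet_derivative u (at x within S) 1)
                    + Im (frechet_derivative u (at x within S) \<i>)"

section \<open>Differential forms on planar domains\<close>

type_synonym form1 = "complex \<Rightarrow> complex \<Rightarrow> real"
type_synonym form2 = "complex \<Rightarrow> complex \<Rightarrow> complex \<Rightarrow> real"

definition one_forms :: "complex set \<Rightarrow> form1 set" where
  "one_forms S = {\<gamma>. (\<forall>x\<in>S. linear (\<gamma> x)) \<and> (\<forall>v. smooth_decaying 1 S (\<lambda>x. \<gamma> x v))}"

definition flat :: "(complex \<Rightarrow> complex) \<Rightarrow> form1" where
  "flat u = (\<lambda>x v. u x \<bullet> v)"

definition d0 :: "complex set \<Rightarrow> (complex \<Rightarrow> real) \<Rightarrow> form1" where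
  "d0 S f = (\<lambda>x v. frechet_derivative f (at x within S) v)"

definition d1 :: "complex set \<Rightarrow> form1 \<Rightarrow> form2" where
  "d1 S \<alpha> = (\<lambda>x v w. frechet_derivative (\<lambda>y. \<alpha> y w) (at x within S) v
                    - frechet_derivative (\<lambda>y. \<alpha> y v) (at x within S) w)"

definition wedge11 :: "form1 \<Rightarrow> form1 \<Rightarrow> form2" where
  "wedge11 \<alpha> \<beta> = (\<lambda>x v w. \<alpha> x v * \<beta> x w - \<alpha> x w * \<beta> x v)"

definition wedge10 :: "form1 \<Rightarrow> (complex \<Rightarrow> real) \<Rightarrow> form1" where
  "wedge10 \<alpha> f = (\<lambda>x v. \<alpha> x v * f x)"

definition hodge_star2 :: "form2 \<Rightarrow> complex \<Rightarrow> real" where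
  "hodge_star2 \<omega> x = \<omega> x 1 \<i>"

text \<open>The pointwise norm is the one for which \<open>dx \<and> dy\<close> has length one.\<close>

definition L2_form2 :: "complex set \<Rightarrow> form2 \<Rightarrow> form2 \<Rightarrow> real" where
  "L2_form2 S \<omega> \<sigma> = (LINT x:S|lborel. \<omega> x 1 \<i> * \<sigma> x 1 \<i>)"

section \<open>The configuration space\<close>

text \<open>
  An element \<open>(a, x\<^sub>0)\<close> of \<open>SE(2)\<close> has \<open>a = cis \<beta>\<close>; a velocity \<open>(\<beta>', x\<^sub>0')\<close> at it is given by
  the angular velocity and the velocity of \<open>x\<^sub>0\<close>.
\<close>

type_synonym se2 = "complex \<times> complex"
type_synonym se2_velocity = "real \<times> complex"

definition SE2 :: "se2 set" where
  "SE2 = {(cis \<beta>, x0) | \<beta> x0. True}"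

definition se2_act :: "se2 \<Rightarrow> complex \<Rightarrow> complex" where
  "se2_act g x = fst g * x + snd g"

definition body0 :: "real \<Rightarrow> complex set" where
  "body0 R = cball 0 R"

definition fluid0 :: "real \<Rightarrow> complex set" where
  "fluid0 R = closure (- body0 R)"

type_synonym config = "se2 \<times> (complex \<Rightarrow> complex)"
type_synonym config_velocity = "se2_velocity \<times> (complex \<Rightarrow> complex)"

definition smooth_embedding :: "complex set \<Rightarrow> (complex \<Rightarrow> complex) \<Rightarrow> bool" where
  "smooth_embedding S \<phi> \<longleftrightarrow> smooth_on S \<phi>
     \<and> (\<forall>x\<in>S. inj (frechet_derivative \<phi> (at x within S)))
     \<and> (\<exists>\<psi>. homeomorphism S (\<phi> ` S) \<phi> \<psi>)"

definition area_form :: "complex \<Rightarrow> complex \<Rightarrow> real" where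
  "area_form v w = Re v * Im w - Im v * Re w"

text \<open>
  Maps and fields on \<^term>\<open>fluid0 R\<close> that are components of configurations, velocities or
  elements of the Lie algebra are total functions normalised to be 0 outside \<^term>\<open>fluid0 R\<close>.
\<close>

definition config_space :: "real \<Rightarrow> config set" where
  "config_space R = {(g, \<phi>). g \<in> SE2
     \<and> smooth_embedding (fluid0 R) \<phi>
     \<and> (\<forall>x\<in>fluid0 R. \<forall>v w.
          area_form (frechet_derivative \<phi> (at x within fluid0 R) v)
                    (frechet_derivative \<phi> (at x within fluid0 R) w) = area_form v w)
     \<and> smooth_decaying 2 (fluid0 R) (\<lambda>x. \<phi> x - x)
     \<and> \<phi> ` frontier (fluid0 R) = se2_act g ` frontier (body0 R)
     \<and> (\<forall>x. x \<notin> fluid0 R \<longrightarrow> \<phi> x = 0)}"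

definition fluid :: "real \<Rightarrow> config \<Rightarrow> complex set" where
  "fluid R q = snd q ` fluid0 R"

text \<open>
  The unit normal at a point \<open>x\<close> of the circle with centre \<open>c\<close>, pointing out of the fluid.
\<close>

definition unit_normal :: "complex \<Rightarrow> complex \<Rightarrow> complex" where
  "unit_normal c x = sgn (c - x)"

definition rigid_velocity :: "config \<Rightarrow> se2_velocity \<Rightarrow> complex \<Rightarrow> complex" where
  "rigid_velocity q gd x =
     complex_of_real (fst gd) * (\<i> * (x - snd (fst q))) + snd gd"

definition eulerian_velocity :: "real \<Rightarrow> config \<Rightarrow> (complex \<Rightarrow> complex) \<Rightarrow> complex \<Rightarrow> complex" where
  "eulerian_velocity R q \<phi>d x = \<phi>d (inv_into (fluid0 R) (snd q) x)"

text \<open>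
  The tangent space at \<open>q\<close>: the infinitesimal versions of area preservation and of
  \<open>\<phi>(\<partial>\<F>\<^sub>0) = g(\<partial>\<B>\<^sub>0)\<close>, expressed through \<open>u = \<phi>' \<circ> \<phi>\<^sup>-\<^sup>1\<close>.
\<close>

definition config_tangent :: "real \<Rightarrow> config \<Rightarrow> config_velocity set" where
  "config_tangent R q = {(gd, \<phi>d).
     (let F = fluid R q; c = snd (fst q); u = eulerian_velocity R q \<phi>d in
       smooth_decaying 2 F u
       \<and> (\<forall>x\<in>F. divergence F u x = 0)
       \<and> (\<forall>x\<in>frontier F. u x \<bullet> unit_normal c x = rigid_velocity q gd x \<bullet> unit_normal c x))
     \<and> (\<forall>x. x \<notin> fluid0 R \<longrightarrow> \<phi>d x = 0)}"

text \<open>Divergence-free fields on \<open>S\<close>, tangent to its boundary circle, whose centre is \<open>c\<close>.\<close>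

definition divfree_tangent :: "nat \<Rightarrow> complex set \<Rightarrow> complex \<Rightarrow> (complex \<Rightarrow> complex) set" where
  "divfree_tangent k S c = {u. smooth_decaying k S u
     \<and> (\<forall>x\<in>S. divergence S u x = 0)
     \<and> (\<forall>x\<in>frontier S. u x \<bullet> unit_normal c x = 0)}"

section \<open>Vector fields on the configuration space and their bracket\<close>

definition smooth_curve :: "real \<Rightarrow> (real \<Rightarrow> config) \<Rightarrow> bool" where
  "smooth_curve R c \<longleftrightarrow> (\<forall>t. c t \<in> config_space R)
     \<and> smooth_on UNIV (\<lambda>t. fst (c t))
     \<and> smooth_on (UNIV \<times> fluid0 R) (\<lambda>(t, x). snd (c t) x)"

text \<open>From \<open>a = cis \<beta>\<close> one gets \<open>a' = \<i> \<beta>' a\<close>, that is \<open>\<beta>' = Im (a' * cnj a)\<close>.\<close>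

definition curve_velocity :: "(real \<Rightarrow> config) \<Rightarrow> real \<Rightarrow> config_velocity" where
  "curve_velocity c t =
     ((Im (vector_derivative (\<lambda>s. fst (fst (c s))) (at t) * cnj (fst (fst (c t)))),
       vector_derivative (\<lambda>s. snd (fst (c s))) (at t)),
      \<lambda>x. vector_derivative (\<lambda>s. snd (c s) x) (at t))"

text \<open>
  Smoothness of maps out of the infinite-dimensional space is understood in the sense of
  convenient calculus: smooth curves are mapped to smooth curves.
\<close>

definition smooth_vector_field :: "real \<Rightarrow> (config \<Rightarrow> config_velocity) \<Rightarrow> bool" where
  "smooth_vector_field R X \<longleftrightarrow> (\<forall>q\<in>config_space R. X q \<in> config_tangent R q)
     \<and> (\<forall>c. smooth_curve R c \<longrightarrow>
          smooth_on UNIV (\<lambda>t. fst (X (c t)))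
          \<and> smooth_on (UNIV \<times> fluid0 R) (\<lambda>(t, x). snd (X (c t)) x))"

definition velocity_derivative :: "(real \<Rightarrow> config_velocity) \<Rightarrow> real \<Rightarrow> config_velocity" where
  "velocity_derivative Y t =
     ((vector_derivative (\<lambda>s. fst (fst (Y s))) (at t),
       vector_derivative (\<lambda>s. snd (fst (Y s))) (at t)),
      \<lambda>x. vector_derivative (\<lambda>s. snd (Y s) x) (at t))"

text \<open>
  \<open>Z = [X, Y](q)\<close> with \<open>[X, Y] = DY \<cdot> X - DX \<cdot> Y\<close>, componentwise in \<open>(\<beta>, x\<^sub>0, \<phi>)\<close>.  The directional
  derivatives are taken along curves in the configuration space that have the prescribed
  velocity.
\<close>

definition is_lie_bracket ::
  "real \<Rightarrow> (config \<Rightarrow> config_velocity) \<Rightarrow> (config \<Rightarrow> config_velocity) \<Rightarrow> config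
    \<Rightarrow> config_velocity \<Rightarrow> bool" where
  "is_lie_bracket R X Y q Z \<longleftrightarrow> (\<exists>c e.
     smooth_curve R c \<and> c 0 = q \<and> curve_velocity c 0 = X q
     \<and> smooth_curve R e \<and> e 0 = q \<and> curve_velocity e 0 = Y q
     \<and> (let A = velocity_derivative (\<lambda>t. Y (c t)) 0; B = velocity_derivative (\<lambda>t. X (e t)) 0
        in Z = (fst A - fst B, \<lambda>x. snd A x - snd B x)))"

section \<open>The Neumann connection and its curvature\<close>

definition neumann_solution ::
  "real \<Rightarrow> config \<Rightarrow> se2_velocity \<Rightarrow> (complex \<Rightarrow> real) \<Rightarrow> bool" where
  "neumann_solution R q gd \<Phi> \<longleftrightarrow>
     (let F = fluid R q; c = snd (fst q) in
       smooth_on F \<Phi>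
       \<and> (\<forall>x\<in>F. laplacian F \<Phi> x = 0)
       \<and> (\<forall>x\<in>frontier F.
            grad F \<Phi> x \<bullet> unit_normal c x = rigid_velocity q gd x \<bullet> unit_normal c x)
       \<and> (\<Phi> \<longlongrightarrow> 0) (inf at_infinity (principal F)))"

text \<open>The solution is unique on the fluid domain, which is all that is used of it.\<close>

definition neumann_potential :: "real \<Rightarrow> config \<Rightarrow> se2_velocity \<Rightarrow> complex \<Rightarrow> real" where
  "neumann_potential R q gd = (SOME \<Phi>. neumann_solution R q gd \<Phi>)"

definition horizontal_part :: "real \<Rightarrow> config \<Rightarrow> config_velocity \<Rightarrow> config_velocity" where
  "horizontal_part R q U = (fst U, \<lambda>x. if x \<in> fluid0 R
     then grad (fluid R q) (neumann_potential R q (fst U)) (snd q x) else 0)"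

definition vortical_part :: "real \<Rightarrow> config \<Rightarrow> config_velocity \<Rightarrow> complex \<Rightarrow> complex" where
  "vortical_part R q U x =
     eulerian_velocity R q (snd U) x - grad (fluid R q) (neumann_potential R q (fst U)) x"

definition pullback_field ::
  "real \<Rightarrow> (complex \<Rightarrow> complex) \<Rightarrow> (complex \<Rightarrow> complex) \<Rightarrow> complex \<Rightarrow> complex" where
  "pullback_field R \<phi> u x = (if x \<in> fluid0 R
     then inv (frechet_derivative \<phi> (at x within fluid0 R)) (u (\<phi> x)) else 0)"

definition neumann_connection :: "real \<Rightarrow> config \<Rightarrow> config_velocity \<Rightarrow> complex \<Rightarrow> complex" where
  "neumann_connection R q U = pullback_field R (snd q) (vortical_part R q U)"

text \<open>
  \<open>w\<close> is the value at \<open>(U, V)\<close> of the curvature at \<open>q\<close>, that is, \<open>w = - A([X\<^sup>H, Y\<^sup>H])(q)\<close> for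
  vector fields \<open>X\<close>, \<open>Y\<close> extending \<open>U\<close>, \<open>V\<close>.  The curvature is a relation rather than a
  description operator, so that what is proved about it holds for every choice of the
  extensions and of the curves computing the bracket.
\<close>

definition is_neumann_curvature ::
  "real \<Rightarrow> config \<Rightarrow> config_velocity \<Rightarrow> config_velocity \<Rightarrow> (complex \<Rightarrow> complex) \<Rightarrow> bool" where
  "is_neumann_curvature R q U V w \<longleftrightarrow> (\<exists>X Y Z.
     smooth_vector_field R X \<and> X q = U
     \<and> smooth_vector_field R Y \<and> Y q = V
     \<and> is_lie_bracket R (\<lambda>p. horizontal_part R p (X p)) (\<lambda>p. horizontal_part R p (Y p)) q Z
     \<and> w = (\<lambda>x. - neumann_connection R q Z x))"

section \<open>The dual of the Lie algebra, and integration over the boundary\<close>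

definition pullback_form :: "real \<Rightarrow> (complex \<Rightarrow> complex) \<Rightarrow> form1 \<Rightarrow> form1" where
  "pullback_form R \<phi> \<alpha> = (\<lambda>x v. \<alpha> (\<phi> x) (frechet_derivative \<phi> (at x within fluid0 R) v))"

definition form_class :: "real \<Rightarrow> form1 \<Rightarrow> form1 set" where
  "form_class R \<gamma> = {\<gamma>' \<in> one_forms (fluid0 R). \<exists>f. smooth_on (fluid0 R) f
     \<and> (\<forall>x\<in>fluid0 R. \<forall>v. \<gamma>' x v = \<gamma> x v + d0 (fluid0 R) f x v)}"

definition Xvol_dual :: "real \<Rightarrow> form1 set set" where
  "Xvol_dual R = form_class R ` one_forms (fluid0 R)"

text \<open>The value does not depend on the representative when \<open>u\<close> lies in the Lie algebra
  \<^term>\<open>divfree_tangent 2 (fluid0 R) 0\<close>.\<close>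

definition dual_pairing :: "real \<Rightarrow> form1 set \<Rightarrow> (complex \<Rightarrow> complex) \<Rightarrow> real" where
  "dual_pairing R \<mu> u = (let \<gamma> = (SOME \<gamma>. \<gamma> \<in> \<mu>) in LINT x:fluid0 R|lborel. \<gamma> x (u x))"

text \<open>
  The boundary of the fluid is the circle \<open>g(\<partial>\<B>\<^sub>0)\<close>; its Stokes orientation as the boundary of
  the exterior domain is clockwise.
\<close>

definition boundary_path :: "real \<Rightarrow> config \<Rightarrow> real \<Rightarrow> complex" where
  "boundary_path R q t = se2_act (fst q) (complex_of_real R * cis (- t))"

definition boundary_integral :: "real \<Rightarrow> config \<Rightarrow> form1 \<Rightarrow> real" where
  "boundary_integral R q \<beta> = integral {0..2 * pi}
     (\<lambda>t. \<beta> (boundary_path R q t) (vector_derivative (boundary_path R q) (at t)))"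

end

theory Submission
  imports Defs
begin

text \<open>
  The idea is that the domain of the fluid is explicit, although the embedding is not.  The image
  \<open>\<phi>(\<F>\<^sub>0)\<close> is closed, \<open>\<phi>\<close> is a bounded perturbation of the identity, and by invariance of domain the
  image of the open exterior is open; a connectedness argument then gives
  \<open>\<F> = {x. R \<le> |x - c|}\<close>, where \<open>c\<close> is the centre of the body.  On this domain the
  rotational part of the rigid motion is tangent to the boundary, so the Neumann potential of
  \<open>(\<beta>', x\<^sub>0')\<close> is the dipole \<open>- R\<^sup>2 Re (V / z)\<close> with \<open>V = x\<^sub>0'\<close> and \<open>z = x - c\<close>; uniqueness is
  a maximum principle.

  Consequently the horizontal part of a vector field at \<open>(g, \<phi>)\<close> is, in the component \<open>\<phi>\<close>, the
  expression \<open>cnj (R\<^sup>2 V / (\<phi> - c)\<^sup>2)\<close>, and the Lie bracket of two horizontal fields can be computed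
  by differentiating it along curves.  The derivatives of \<open>V\<close> contribute precisely the horizontal
  part of the bracket.  What remains is purely vortical, and minus that remainder is the Eulerian form of
  the curvature: the circular flow \<open>4 J \<i> z / |z|\<^sup>6\<close> with \<open>J = R\<^sup>4 Im (V\<^sub>1 cnj V\<^sub>2)\<close>
  (lemma \<open>neumann_curvature_swirl\<close>).

  On the other side, \<open>\<star>(d\<Phi>\<^sub>1 \<and> d\<Phi>\<^sub>2) = J / |z|\<^sup>4\<close>, whose gradient is \<open>- 4 J z / |z|\<^sup>6\<close>.  Thus the
  claim is Stokes' theorem for \<open>(J / |z|\<^sup>4) \<alpha>\<close>, together with the fact that an exact form pairs
  to zero with the circular flow.  Both are proved in polar coordinates: every term of the integrand is
  either a radial derivative, which leaves a boundary term, or an angular derivative, which leaves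
  nothing (lemmas \<open>weighted_stokes_exterior\<close> and \<open>swirl_pairing\<close>).  The area-preserving map \<open>\<phi>\<close>
  transports the pairing from \<open>\<F>\<^sub>0\<close> to \<open>\<F>\<close> by the change of variables formula.
\<close>

section \<open>Change of variables in the plane\<close>

text \<open>
  The multivariate change of variables formula concerns the spaces \<open>real ^ 'n\<close>; this isometry
  carries it over to the complex plane.
\<close>

definition vec_to_complex :: "real^2 \<Rightarrow> complex" where
  "vec_to_complex v = Complex (v $ 1) (v $ 2)"

definition complex_to_vec :: "complex \<Rightarrow> real^2" where
  "complex_to_vec z = vector [Re z, Im z]"

lemma vec_to_complex_inverse [simp]:
  "complex_to_vec (vec_to_complex v) = v" "vec_to_complex (complex_to_vec z) = z"
  by (simp_all add: vec_to_complex_def complex_to_vec_def vec_eq_iff forall_2)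

lemma bounded_linear_vec_to_complex: "bounded_linear vec_to_complex"
  by (rule linear_conv_bounded_linear[THEN iffD1], rule linearI)
     (auto simp: vec_to_complex_def complex_eq_iff)

lemma bounded_linear_complex_to_vec: "bounded_linear complex_to_vec"
  by (rule linear_conv_bounded_linear[THEN iffD1], rule linearI)
     (auto simp: complex_to_vec_def vec_eq_iff forall_2)

lemma measurable_vec_to_complex [measurable]: "vec_to_complex \<in> borel \<rightarrow>\<^sub>M borel"
  by (intro borel_measurable_continuous_onI linear_continuous_on bounded_linear_vec_to_complex)

lemma lborel_complex_vec: "(lborel :: complex measure) = distr lborel borel vec_to_complex"
proof (rule lborel_eqI)
  fix l u :: complex
  assume lu: "\<And>b. b \<in> Basis \<Longrightarrow> l \<bullet> b \<le> u \<bullet> b"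
  have vim: "vec_to_complex -` box l u = box (complex_to_vec l) (complex_to_vec u)"
    by (auto simp: box_def vec_to_complex_def complex_to_vec_def Basis_complex_def Basis_vec_def
        inner_axis forall_2 UNIV_2)
  have "\<forall>b\<in>Basis. complex_to_vec l \<bullet> b \<le> complex_to_vec u \<bullet> b"
    using lu[of 1] lu[of \<i>]
    by (auto simp: Basis_vec_def complex_to_vec_def inner_axis forall_2 UNIV_2 Basis_complex_def)
  moreover have "axis 1 (1::real) \<noteq> (axis 2 1 :: real^2)"
    by (simp add: axis_eq_axis)
  ultimately show "emeasure (distr lborel borel vec_to_complex) (box l u) = (\<Prod>b\<in>Basis. (u - l) \<bullet> b)"
    by (subst emeasure_distr)
       (auto simp: vim emeasure_lborel_box_eq Basis_vec_def UNIV_2 inner_axis Basis_complex_def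
         complex_to_vec_def ennreal_mult' inner_diff_left mult.commute)
qed simp

lemma lborel_complex_pair: "(lborel :: complex measure) = distr (lborel \<Otimes>\<^sub>M lborel) borel (\<lambda>(r, t). Complex r t)"
proof (rule lborel_eqI)
  have [measurable]: "(\<lambda>(r, t). Complex r t) \<in> borel \<rightarrow>\<^sub>M borel"
    by (intro borel_measurable_continuous_onI)
       (auto simp: case_prod_beta Complex_eq intro!: continuous_intros)
  fix l u :: complex
  assume lu: "\<And>b. b \<in> Basis \<Longrightarrow> l \<bullet> b \<le> u \<bullet> b"
  have vim: "(\<lambda>(r, t). Complex r t) -` box l u = box (Re l, Im l) (Re u, Im u)"
    by (auto simp: box_def Basis_complex_def Basis_prod_def)
  show "emeasure (distr (lborel \<Otimes>\<^sub>M lborel) borel (\<lambda>(r, t). Complex r t)) (box l u) = (\<Prod>b\<in>Basis. (u - l) \<bullet> b)"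
    using lu[of 1] lu[of \<i>] unfolding lborel_prod
    by (subst emeasure_distr)
       (auto simp: vim emeasure_lborel_box_eq Basis_prod_def Basis_complex_def 
         ennreal_mult' inner_diff_left mult.commute)
qed simp

lemma set_integral_complex_vec:
  fixes h :: "complex \<Rightarrow> real"
  assumes h: "set_borel_measurable borel S h"
  shows "set_integrable lborel S h \<longleftrightarrow> set_integrable lebesgue (vec_to_complex -` S) (\<lambda>v. h (vec_to_complex v))"
    and "(LINT z:S|lborel. h z) = (LINT v:vec_to_complex -` S|lebesgue. h (vec_to_complex v))"
proof -
  let ?k = "\<lambda>z. indicat_real S z *\<^sub>R h z"
  have k [measurable]: "?k \<in> borel_measurable borel"
    using h unfolding set_borel_measurable_def .
  have eq: "(\<lambda>v. indicat_real (vec_to_complex -` S) v *\<^sub>R h (vec_to_complex v)) = (\<lambda>v. ?k (vec_to_complex v))"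
    by (auto simp: indicator_def)
  have m: "(\<lambda>v. ?k (vec_to_complex v)) \<in> borel_measurable lborel"
    by measurable
  show "set_integrable lborel S h \<longleftrightarrow> set_integrable lebesgue (vec_to_complex -` S) (\<lambda>v. h (vec_to_complex v))"
    unfolding set_integrable_def eq integrable_completion[OF m]
    by (subst lborel_complex_vec, subst integrable_distr_eq) (use k in auto)
  show "(LINT z:S|lborel. h z) = (LINT v:vec_to_complex -` S|lebesgue. h (vec_to_complex v))"
    unfolding set_lebesgue_integral_def eq integral_completion[OF m]
    by (subst lborel_complex_vec, subst integral_distr) (use k in auto)
qed

text \<open>
  The Jacobian determinant of a real-linear map of the plane is the area form of the images of \<open>1\<close> and
  \<open>\<i>\<close>.  Integrability on either side suffices, so integrability can be established wherever it is easier.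
\<close>

lemma change_of_variables_complex:
  fixes f :: "complex \<Rightarrow> real" and g :: "complex \<Rightarrow> complex"
  assumes S: "S \<in> sets borel"
    and der: "\<And>x. x \<in> S \<Longrightarrow> (g has_derivative g' x) (at x within S)"
    and inj: "inj_on g S"
    and m1: "set_borel_measurable borel S (\<lambda>x. \<bar>area_form (g' x 1) (g' x \<i>)\<bar> * f (g x))"
    and m2: "set_borel_measurable borel (g ` S) f"
    and int: "set_integrable lborel S (\<lambda>x. \<bar>area_form (g' x 1) (g' x \<i>)\<bar> * f (g x)) \<or> set_integrable lborel (g ` S) f"
  shows "set_integrable lborel S (\<lambda>x. \<bar>area_form (g' x 1) (g' x \<i>)\<bar> * f (g x))" 
    and "set_integrable lborel (g ` S) f"
    and "(LINT x:S|lborel. \<bar>area_form (g' x 1) (g' x \<i>)\<bar> * f (g x)) = (LINT y:g ` S|lborel. f y)"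
proof -
  let ?L = vec_to_complex and ?M = complex_to_vec
  let ?S = "?L -` S" and ?g = "\<lambda>v. ?M (g (?L v))" and ?g' = "\<lambda>v h. ?M (g' (?L v) (?L h))"
  let ?f = "\<lambda>v. vec (f (?L v)) :: real^1"
  have S': "?S \<in> sets lebesgue"
    using measurable_sets[OF measurable_vec_to_complex S] by simp
  have im: "?g ` ?S = ?L -` (g ` S)"
  proof (intro equalityI subsetI)
    fix v assume "v \<in> ?L -` (g ` S)"
    then obtain x where "x \<in> S" "?L v = g x" by auto
    then have "v = ?g (?M x)" "?M x \<in> ?S" by (simp_all flip: \<open>?L v = g x\<close>)
    then show "v \<in> ?g ` ?S" by blast
  qed auto
  have lin: "(?L has_derivative ?L) (at v within T)" "(?M has_derivative ?M) (at z within U)" for v z T U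
    by (intro bounded_linear_imp_has_derivative bounded_linear_vec_to_complex bounded_linear_complex_to_vec)+
  have d: "(?g has_derivative ?g' v) (at v within ?S)" if "v \<in> ?S" for v
  proof -
    have "(g has_derivative g' (?L v)) (at (?L v) within ?L ` ?S)"
      by (rule has_derivative_subset[OF der]) (use that in auto)
    from diff_chain_within[OF lin(1) this] have "(g \<circ> ?L has_derivative g' (?L v) \<circ> ?L) (at v within ?S)" .
    from diff_chain_within[OF this lin(2)] show ?thesis by (simp add: o_def)
  qed
  have i: "inj_on ?g ?S"
  proof (rule inj_onI)
    fix v w assume "v \<in> ?S" "w \<in> ?S" "?g v = ?g w"
    then have "g (?L v) = g (?L w)" by (metis vec_to_complex_inverse(2))
    then have "?L v = ?L w" using \<open>v \<in> ?S\<close> \<open>w \<in> ?S\<close> inj by (auto dest: inj_onD)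
    then show "v = w" by (metis vec_to_complex_inverse(1))
  qed
  have ax: "?L (axis 1 1) = 1" "?L (axis 2 1) = \<i>"
    by (simp_all add: vec_to_complex_def axis_def complex_eq_iff)
  have det: "det (matrix (?g' v)) = area_form (g' (?L v) 1) (g' (?L v) \<i>)" for v
    by (simp add: det_2 matrix_def ax complex_to_vec_def area_form_def mult.commute)
  note CV = has_absolute_integral_change_of_variables[OF S' d i, where f="?f"]
  have 1: "(\<lambda>v. \<bar>det (matrix (?g' v))\<bar> *\<^sub>R ?f (?g v)) = (\<lambda>v. vec (\<bar>area_form (g' (?L v) 1) (g' (?L v) \<i>)\<bar> * f (g (?L v))))"
    by (auto simp: det vec_eq_iff)
  note CV' = CV[unfolded 1 absolutely_integrable_on_1_iff integral_on_1_eq im, of "vec b" for b, simplified]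
  have CV'': "set_integrable lborel S (\<lambda>x. \<bar>area_form (g' x 1) (g' x \<i>)\<bar> * f (g x)) \<and>
      (LINT x:S|lborel. \<bar>area_form (g' x 1) (g' x \<i>)\<bar> * f (g x)) = b \<longleftrightarrow>
      set_integrable lborel (g ` S) f \<and> (LINT y:g ` S|lborel. f y) = b" for b
    unfolding set_integral_complex_vec[OF m1] set_integral_complex_vec[OF m2]
    using CV'[of b] set_lebesgue_integral_eq_integral by (auto simp: vec_eq_iff)
  \<comment> \<open>The equivalence holds for every value \<open>b\<close>, hence also for the two integrals themselves.\<close>
  show "set_integrable lborel S (\<lambda>x. \<bar>area_form (g' x 1) (g' x \<i>)\<bar> * f (g x))" 
    "set_integrable lborel (g ` S) f"
    "(LINT x:S|lborel. \<bar>area_form (g' x 1) (g' x \<i>)\<bar> * f (g x)) = (LINT y:g ` S|lborel. f y)"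
    using int CV'' by metis+
qed

section \<open>Integration in polar coordinates\<close>

lemma linear_complex_components:
  assumes "linear D"
  shows "D v = Re v *\<^sub>R D 1 + Im v *\<^sub>R D \<i>"
proof -
  have "D v = D (Re v *\<^sub>R 1 + Im v *\<^sub>R \<i>)"
    by (rule arg_cong[where f=D]) (simp add: complex_eq_iff)
  then show ?thesis
    by (simp only: linear_add[OF assms] linear_scale[OF assms])
qed

definition exterior :: "complex \<Rightarrow> real \<Rightarrow> complex set" where
  "exterior c R = {x. R \<le> norm (x - c)}"

text \<open>
  Integrals over the exterior of a disc become integrals over this half-open strip, on which polar
  coordinates are injective.
\<close>

definition strip_integral :: "real \<Rightarrow> (real \<Rightarrow> real \<Rightarrow> real) \<Rightarrow> real" where
  "strip_integral R K = (LINT p:{R..} \<times> {0..<2 * pi}|lborel \<Otimes>\<^sub>M lborel. K (fst p) (snd p))"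

text \<open>
  The integrands that occur extend continuously to the closed strip and decay at least like the inverse
  cube of the radius, which makes Fubini's theorem and passage to the limit in the radius
  automatic.
\<close>

definition strip_dominated :: "real \<Rightarrow> (real \<Rightarrow> real \<Rightarrow> real) \<Rightarrow> bool" where
  "strip_dominated R K \<longleftrightarrow> continuous_on ({R..} \<times> {0..2 * pi}) (\<lambda>p. K (fst p) (snd p))
     \<and> (\<exists>C. \<forall>r\<ge>R. \<forall>t\<in>{0..2*pi}. \<bar>K r t\<bar> \<le> C / r ^ 3)"

lemma set_integrable_inverse_cube:
  fixes R C :: real
  assumes "0 < R"
  shows "set_integrable lborel {R..} (\<lambda>r. C / r ^ 3)"
proof -
  have "((\<lambda>x. 1 / x ^ 3) has_integral 1 / (real (3 - 1) * R ^ (3 - 1))) {R..}"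
    by (rule has_integral_inverse_power_to_inf) (use assms in auto)
  then have "(\<lambda>x. 1 / x ^ 3) absolutely_integrable_on {R..}"
    by (intro nonnegative_absolutely_integrable_1) (use assms in \<open>auto simp: integrable_on_def\<close>)
  moreover have "(\<lambda>x. indicat_real {R..} x *\<^sub>R (1 / x ^ 3)) \<in> borel_measurable lborel"
    by measurable
  ultimately have "set_integrable lborel {R..} (\<lambda>x. 1 / x ^ 3)"
    unfolding set_integrable_def by (simp add: integrable_completion)
  then have "set_integrable lborel {R..} (\<lambda>x. C * (1 / x ^ 3))"
    by (rule set_integrable_mult_right)
  then show ?thesis by simp
qed

lemma strip_dominatedE:
  assumes "strip_dominated R K" "0 < R"
  obtains C where "0 \<le> C" "\<And>r t. R \<le> r \<Longrightarrow> 0 \<le> t \<Longrightarrow> t \<le> 2 * pi \<Longrightarrow> \<bar>K r t\<bar> \<le> C / r ^ 3"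
proof -
  obtain C where C: "\<And>r t. R \<le> r \<Longrightarrow> 0 \<le> t \<Longrightarrow> t \<le> 2 * pi \<Longrightarrow> \<bar>K r t\<bar> \<le> C / r ^ 3"
    using assms unfolding strip_dominated_def by force
  have "0 \<le> C / R ^ 3" using C[of R 0] by simp
  then have "0 \<le> C" using assms(2) by (simp add: zero_le_divide_iff)
  with C that show thesis by blast
qed

lemma strip_dominated_slices:
  assumes K: "strip_dominated R K" "0 < R"
  shows "0 \<le> t \<Longrightarrow> t \<le> 2 * pi \<Longrightarrow> set_integrable lborel {R..} (\<lambda>r. K r t)"
    and "R \<le> r \<Longrightarrow> continuous_on {0..2*pi} (K r)"
proof -
  have cont: "continuous_on ({R..} \<times> {0..2 * pi}) (\<lambda>p. K (fst p) (snd p))"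
    using K unfolding strip_dominated_def by blast
  show "continuous_on {0..2*pi} (K r)" if "R \<le> r"
    by (rule continuous_on_compose2[OF cont, of _ "\<lambda>t. (r, t)", simplified])
       (use that in \<open>auto intro!: continuous_on_Pair continuous_on_const continuous_on_id\<close>)
  have c: "continuous_on {R..} (\<lambda>r. K r t)" if "0 \<le> t" "t \<le> 2 * pi"
    by (rule continuous_on_compose2[OF cont, of _ "\<lambda>r. (r, t)", simplified])
       (use that in \<open>auto intro!: continuous_on_Pair continuous_on_const continuous_on_id\<close>)
  show "set_integrable lborel {R..} (\<lambda>r. K r t)" if t: "0 \<le> t" "t \<le> 2 * pi"
  proof -
    obtain C where C: "0 \<le> C" "\<And>r t. R \<le> r \<Longrightarrow> 0 \<le> t \<Longrightarrow> t \<le> 2 * pi \<Longrightarrow> \<bar>K r t\<bar> \<le> C / r ^ 3"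
      using strip_dominatedE[OF K] by blast
    show "set_integrable lborel {R..} (\<lambda>r. K r t)"
    proof (rule set_integrable_bound[OF set_integrable_inverse_cube[OF K(2), of C]])
      show "set_borel_measurable lborel {R..} (\<lambda>r. K r t)"
        unfolding set_borel_measurable_def
        using borel_measurable_continuous_on_indicator[OF _ c[OF t]] by simp
      show "AE x in lborel. x \<in> {R..} \<longrightarrow> norm (K x t) \<le> norm (C / x ^ 3)"
      proof (intro AE_I2 impI)
        fix x :: real assume "x \<in> {R..}"
        then have "0 < x" using K(2) by auto
        with C t \<open>x \<in> {R..}\<close> show "norm (K x t) \<le> norm (C / x ^ 3)" by auto
      qed
    qed
  qed
qed

lemma set_integrable_strip:
  assumes K: "strip_dominated R K" "0 < R"
  shows "set_integrable (lborel \<Otimes>\<^sub>M lborel) ({R..} \<times> {0..<2 * pi}) (\<lambda>p. K (fst p) (snd p))"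
proof -
  have cont: "continuous_on ({R..} \<times> {0..2 * pi}) (\<lambda>p. K (fst p) (snd p))"
    using K unfolding strip_dominated_def by blast
  obtain C where C: "0 \<le> C" "\<And>r t. R \<le> r \<Longrightarrow> 0 \<le> t \<Longrightarrow> t \<le> 2 * pi \<Longrightarrow> \<bar>K r t\<bar> \<le> C / r ^ 3"
    using strip_dominatedE[OF K] by blast
  let ?S = "{R..} \<times> {0..<2 * pi}"
  have S: "?S \<in> sets borel"
    by (intro borel_Times) auto
  have S': "?S \<in> sets (lborel \<Otimes>\<^sub>M lborel)"
    unfolding lborel_prod using S by simp
  let ?b = "\<lambda>p::real\<times>real. indicat_real {R..} (fst p) * (C / fst p ^ 3) * indicat_real {0..<2*pi} (snd p)"
  have b1: "integrable lborel (\<lambda>x. indicat_real {R..} x * (C / x ^ 3))"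
    using set_integrable_inverse_cube[OF K(2), of C] unfolding set_integrable_def by simp
  have b: "integrable (lborel \<Otimes>\<^sub>M lborel) ?b"
  proof (rule lborel_pair.Fubini_integrable)
    show "?b \<in> borel_measurable (lborel \<Otimes>\<^sub>M lborel)" by measurable
    show "integrable lborel (\<lambda>x. \<integral>y. norm (?b (x, y)) \<partial>lborel)"
      using integrable_mult_left[OF integrable_norm[OF b1], of "2*pi"] by (simp add: abs_mult)
    show "AE x in lborel. integrable lborel (\<lambda>y. ?b (x, y))"
      by (auto intro!: AE_I2 integrable_real_indicator)
  qed
  have m: "(\<lambda>p. indicator ?S p *\<^sub>R K (fst p) (snd p)) \<in> borel_measurable (lborel \<Otimes>\<^sub>M lborel)"
    unfolding lborel_prod
    using borel_measurable_continuous_on_indicator[OF S continuous_on_subset[OF cont]]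
    by (auto simp: subset_iff)
  show ?thesis
    unfolding set_integrable_def
  proof (rule Bochner_Integration.integrable_bound[OF b m], rule AE_I2, clarify)
    fix r t :: real
    show "norm (indicat_real ?S (r, t) *\<^sub>R K (fst (r, t)) (snd (r, t))) \<le> norm (?b (r, t))"
      using C(2)[of r t] C(1) K(2) by (auto simp: indicator_def)
  qed
qed

lemma strip_integral_iterated:
  assumes K: "strip_dominated R K" "0 < R"
  shows "strip_integral R K = (LINT r:{R..}|lborel. integral {0..2*pi} (K r))" 
    and "strip_integral R K = (LINT t:{0..<2*pi}|lborel. (LINT r:{R..}|lborel. K r t))" 
proof -
  let ?k = "\<lambda>r t. indicat_real ({R..} \<times> {0..<2 * pi}) (r, t) *\<^sub>R K r t"
  have int: "integrable (lborel \<Otimes>\<^sub>M lborel) (\<lambda>(r, t). ?k r t)"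
    using set_integrable_strip[OF K] by (simp only: set_integrable_def case_prod_beta' prod.collapse)
  have "strip_integral R K = (\<integral>r. (\<integral>t. ?k r t \<partial>lborel) \<partial>lborel)"
    unfolding strip_integral_def set_lebesgue_integral_def
    using lborel_pair.integral_fst'[OF int] by (simp only: case_prod_beta' prod.collapse fst_conv snd_conv)
  also have "\<dots> = (LINT r:{R..}|lborel. (LINT t:{0..<2*pi}|lborel. K r t))"
    unfolding set_lebesgue_integral_def
    by (intro Bochner_Integration.integral_cong refl) (auto simp: indicator_def)
  also have "\<dots> = (LINT r:{R..}|lborel. integral {0..2*pi} (K r))"
  proof (rule set_lebesgue_integral_cong, simp, intro allI impI)
    fix r assume "r \<in> {R..}"
    then have c: "continuous_on {0..2*pi} (K r)" using strip_dominated_slices(2)[OF K] by simp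
    have "set_integrable lborel {0..2*pi} (K r)"
      by (rule borel_integrable_atLeastAtMost') (rule c)
    then have i: "set_integrable lborel {0..<2*pi} (K r)"
      by (rule set_integrable_subset) auto
    have "(LINT t:{0..<2*pi}|lborel. K r t) = integral {0..<2*pi} (K r)"
      by (rule set_borel_integral_eq_integral(2)[OF i])
    also have "\<dots> = integral {0..2*pi} (K r)"
      by (rule integral_subset_negligible) (auto intro: negligible_subset[of "{2*pi}"])
    finally show "(LINT t:{0..<2*pi}|lborel. K r t) = integral {0..2*pi} (K r)" .
  qed
  finally show "strip_integral R K = (LINT r:{R..}|lborel. integral {0..2*pi} (K r))" .
  have "strip_integral R K = (\<integral>t. (\<integral>r. ?k r t \<partial>lborel) \<partial>lborel)"
    unfolding strip_integral_def set_lebesgue_integral_def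
    using lborel_pair.integral_snd[OF int] by (simp only: case_prod_beta' prod.collapse fst_conv snd_conv)
  also have "\<dots> = (LINT t:{0..<2*pi}|lborel. (LINT r:{R..}|lborel. K r t))"
    unfolding set_lebesgue_integral_def
    by (intro Bochner_Integration.integral_cong refl) (auto simp: indicator_def)
  finally show "strip_integral R K = (LINT t:{0..<2*pi}|lborel. (LINT r:{R..}|lborel. K r t))" .
qed

text \<open>
  Integrating first over the angle gives the increment of a periodic function.
\<close>

lemma strip_integral_angular_derivative:
  assumes K: "strip_dominated R K" "0 < R"
    and Q: "\<And>r t. R \<le> r \<Longrightarrow> t \<in> {0..2*pi} \<Longrightarrow> (Q r has_vector_derivative K r t) (at t within {0..2*pi})"
    and per: "\<And>r. R \<le> r \<Longrightarrow> Q r (2*pi) = Q r 0"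
  shows "strip_integral R K = 0"
proof -
  have "integral {0..2*pi} (K r) = 0" if "R \<le> r" for r
    using integral_unique[OF fundamental_theorem_of_calculus[OF _ Q[OF that]]] per[OF that] by simp
  then have "(LINT r:{R..}|lborel. integral {0..2*pi} (K r)) = (LINT r:{R..}|lborel. 0)"
    by (intro set_lebesgue_integral_cong) auto
  then show ?thesis unfolding strip_integral_iterated(1)[OF K] by (simp add: set_lebesgue_integral_def)
qed

text \<open>
  Integrating first over the radius leaves only the value at the inner end.
\<close>

lemma strip_integral_radial_derivative:
  assumes K: "strip_dominated R K" "0 < R"
    and P: "\<And>r t. R \<le> r \<Longrightarrow> t \<in> {0..2*pi} \<Longrightarrow> ((\<lambda>r. P r t) has_vector_derivative K r t) (at r within {R..})"
    and lim: "\<And>t. t \<in> {0..2*pi} \<Longrightarrow> ((\<lambda>r. P r t) \<longlongrightarrow> 0) at_top"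
    and cont: "continuous_on {0..2*pi} (P R)"
  shows "strip_integral R K = - integral {0..2*pi} (P R)"
proof -
  have inner: "(LINT r:{R..}|lborel. K r t) = - P R t" if t: "t \<in> {0..2*pi}" for t
  proof -
    have i: "set_integrable lborel {R..} (\<lambda>r. K r t)"
      using strip_dominated_slices(1)[OF K] t by simp
    then have "((\<lambda>y. \<integral>x. indicator {..y} x *\<^sub>R (indicator {R..} x *\<^sub>R K x t) \<partial>lborel) \<longlongrightarrow>
        (\<integral>x. indicator {R..} x *\<^sub>R K x t \<partial>lborel)) at_top"
      unfolding set_integrable_def by (intro tendsto_integral_at_top) auto
    moreover have "\<forall>\<^sub>F y in at_top. (\<integral>x. indicator {..y} x *\<^sub>R (indicator {R..} x *\<^sub>R K x t) \<partial>lborel) = P y t - P R t"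
      using eventually_ge_at_top[of R]
    proof eventually_elim
      case (elim y)
      have i': "set_integrable lborel {R..y} (\<lambda>r. K r t)"
        by (rule set_integrable_subset[OF i]) auto
      have "(\<integral>x. indicator {..y} x *\<^sub>R (indicator {R..} x *\<^sub>R K x t) \<partial>lborel) = (LINT r:{R..y}|lborel. K r t)"
        unfolding set_lebesgue_integral_def
        by (intro Bochner_Integration.integral_cong refl) (auto simp: indicator_def)
      also have "\<dots> = integral {R..y} (\<lambda>r. K r t)"
        by (rule set_borel_integral_eq_integral(2)[OF i'])
      also have "\<dots> = P y t - P R t"
        by (intro integral_unique fundamental_theorem_of_calculus elim)
           (use t in \<open>auto intro!: has_vector_derivative_within_subset[OF P]\<close>)
      finally show ?case .
    qed
    ultimately have "((\<lambda>y. P y t - P R t) \<longlongrightarrow> (LINT r:{R..}|lborel. K r t)) at_top"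
      unfolding set_lebesgue_integral_def by (rule Lim_transform_eventually)
    moreover have "((\<lambda>y. P y t - P R t) \<longlongrightarrow> 0 - P R t) at_top"
      by (intro tendsto_intros lim t)
    ultimately show ?thesis
      using tendsto_unique trivial_limit_at_top_linorder by force
  qed
  have "strip_integral R K = (LINT t:{0..<2*pi}|lborel. - P R t)"
    unfolding strip_integral_iterated(2)[OF K]
    by (intro set_lebesgue_integral_cong) (auto simp: inner)
  also have "\<dots> = integral {0..<2*pi} (\<lambda>t. - P R t)"
    by (intro set_borel_integral_eq_integral(2) set_integrable_subset[OF borel_integrable_atLeastAtMost'[of 0 "2*pi"]] 
        continuous_intros cont) auto
  also have "\<dots> = integral {0..2*pi} (\<lambda>t. - P R t)"
    by (rule integral_subset_negligible) (auto intro: negligible_subset[of "{2*pi}"])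
  finally show ?thesis by simp
qed

lemma strip_integral_add:
  assumes "strip_dominated R K" "strip_dominated R L" "0 < R"
  shows "strip_integral R (\<lambda>r t. K r t + L r t) = strip_integral R K + strip_integral R L"
  unfolding strip_integral_def
  by (intro set_integral_add(2) set_integrable_strip assms)

lemma strip_integral_cong:
  assumes "\<And>r t. R \<le> r \<Longrightarrow> 0 \<le> t \<Longrightarrow> t < 2 * pi \<Longrightarrow> K r t = L r t"
  shows "strip_integral R K = strip_integral R L"
  unfolding strip_integral_def set_lebesgue_integral_def
  by (intro Bochner_Integration.integral_cong refl) (auto simp: indicator_def assms)

definition polar :: "complex \<Rightarrow> real \<Rightarrow> real \<Rightarrow> complex" where
  "polar c r t = c + complex_of_real r * cis t"

lemma norm_polar [simp]: "0 \<le> r \<Longrightarrow> norm (polar c r t - c) = r"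
  by (simp add: polar_def norm_mult)

lemma polar_exterior: "0 < R \<Longrightarrow> R \<le> r \<Longrightarrow> polar c r t \<in> exterior c R"
  by (simp add: exterior_def)

lemma continuous_on_polar [continuous_intros]:
  "continuous_on S f \<Longrightarrow> continuous_on S g \<Longrightarrow> continuous_on S (\<lambda>x. polar c (f x) (g x))"
  unfolding polar_def by (intro continuous_intros)

lemma closed_exterior [simp]: "closed (exterior c R)"
  unfolding exterior_def by (intro closed_Collect_le continuous_intros)

text \<open>
  The change of variables is applied to \<open>r + \<i> t \<mapsto> c + r cis t\<close>, whose Jacobian is \<open>r\<close>.
\<close>

lemma integral_exterior_polar:
  assumes "0 < R" and cont: "continuous_on (exterior c R) G"
    and bound: "\<And>y. y \<in> exterior c R \<Longrightarrow> \<bar>G y\<bar> \<le> C / norm (y - c) ^ 4"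
  shows "strip_dominated R (\<lambda>r t. r * G (polar c r t))"
    and "set_integrable lborel (exterior c R) G"
    and "(LINT y:exterior c R|lborel. G y) = strip_integral R (\<lambda>r t. r * G (polar c r t))"
proof -
  have "continuous_on ({R..} \<times> {0..2 * pi}) (\<lambda>p. fst p * G (polar c (fst p) (snd p)))"
    by (intro continuous_intros continuous_on_compose2[OF cont])
       (use assms(1) in \<open>auto simp: polar_exterior\<close>)
  moreover have "\<bar>r * G (polar c r t)\<bar> \<le> C / r ^ 3" if "R \<le> r" for r t
  proof -
    have r: "0 < r" using that assms by simp
    then have "\<bar>r * G (polar c r t)\<bar> \<le> r * (C / r ^ 4)"
      using bound[OF polar_exterior[OF assms(1) that, of c t]]
      by (simp only: abs_mult abs_of_pos norm_polar less_imp_le mult_le_cancel_left_pos)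
    also have "\<dots> = C / r ^ 3" using r by (simp add: field_simps eval_nat_numeral)
    finally show ?thesis .
  qed
  ultimately show dom: "strip_dominated R (\<lambda>r t. r * G (polar c r t))"
    unfolding strip_dominated_def by blast
  define S where "S = {z. R \<le> Re z \<and> 0 \<le> Im z \<and> Im z < 2 * pi}"
  define g where "g z = polar c (Re z) (Im z)" for z
  define g' where "g' z h = complex_of_real (Re h) * cis (Im z) + complex_of_real (Re z) * (complex_of_real (Im h) * (\<i> * cis (Im z)))" for z h
  have S: "S \<in> sets borel" unfolding S_def by measurable
  have der: "(g has_derivative g' z) (at z within T)" for z T
  proof -
    show ?thesis unfolding g_def polar_def g'_def[abs_def]
      by (rule derivative_eq_intros refl bounded_linear_imp_has_derivative bounded_linear_Re bounded_linear_Im)+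
         (auto simp: fun_eq_iff algebra_simps scaleR_conv_of_real)
  qed
  have jac: "\<bar>area_form (g' z 1) (g' z \<i>)\<bar> = \<bar>Re z\<bar>" for z
  proof -
    have "area_form (g' z 1) (g' z \<i>) = Re z * (cos (Im z) * cos (Im z) + sin (Im z) * sin (Im z))"
      unfolding g'_def area_form_def by (simp add: algebra_simps del: sin_cos_squared_add3)
    then show ?thesis by simp
  qed
  have im: "g ` S = exterior c R"
  proof (intro equalityI subsetI)
    fix y assume "y \<in> exterior c R"
    then have "R \<le> norm (y - c)" by (simp add: exterior_def)
    moreover have "y - c = norm (y - c) * cis (Arg2pi (y - c))"
      using Arg2pi_eq[of "y - c"] by (simp add: cis_conv_exp)
    ultimately have "y = g (Complex (norm (y - c)) (Arg2pi (y - c)))"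
        "Complex (norm (y - c)) (Arg2pi (y - c)) \<in> S"
      by (auto simp: g_def polar_def S_def Arg2pi_ge_0 Arg2pi_lt_2pi)
    then show "y \<in> g ` S" by blast
  qed (use assms(1) in \<open>auto simp: g_def S_def polar_exterior\<close>)
  have inj: "inj_on g S"
  proof (rule inj_onI)
    fix z w assume zw: "z \<in> S" "w \<in> S" "g z = g w"
    have "Re z = norm (g z - c)" "Re w = norm (g w - c)"
      using zw(1,2) assms(1) by (auto simp: g_def S_def)
    with zw have r: "Re z = Re w" by simp
    with zw assms(1) have "cis (Im z) = cis (Im w)" by (auto simp: g_def polar_def S_def)
    then have "Arg2pi (cis (Im z)) = Arg2pi (cis (Im w))" by simp
    moreover have "Arg2pi (cis t) = t" if "0 \<le> t" "t < 2 * pi" for t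
      by (rule Arg2pi_unique[where r=1]) (use that in \<open>auto simp: cis_conv_exp\<close>)
    ultimately have "Im z = Im w" using zw by (simp add: S_def)
    with r show "z = w" by (simp add: complex_eq_iff)
  qed
  have m1: "set_borel_measurable borel S (\<lambda>z. \<bar>area_form (g' z 1) (g' z \<i>)\<bar> * G (g z))"
  proof -
    have "continuous_on S (\<lambda>z. \<bar>Re z\<bar> * G (g z))"
      unfolding g_def
      by (intro continuous_intros continuous_on_compose2[OF cont])
         (use assms(1) in \<open>auto simp: S_def polar_exterior\<close>)
    then show ?thesis unfolding jac set_borel_measurable_def
      using borel_measurable_continuous_on_indicator[OF S] by blast
  qed
  have m2: "set_borel_measurable borel (g ` S) G"
    unfolding im set_borel_measurable_def
    by (rule borel_measurable_continuous_on_indicator[OF _ cont]) simp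
  have [measurable]: "(\<lambda>(r, t). Complex r t) \<in> borel \<rightarrow>\<^sub>M borel"
    by (intro borel_measurable_continuous_onI)
       (auto simp: case_prod_beta Complex_eq intro!: continuous_intros)
  then have cm [measurable]: "(\<lambda>(r, t). Complex r t) \<in> lborel \<Otimes>\<^sub>M lborel \<rightarrow>\<^sub>M borel"
    unfolding lborel_prod by simp
  let ?k = "\<lambda>z. indicat_real S z *\<^sub>R (\<bar>area_form (g' z 1) (g' z \<i>)\<bar> * G (g z))"
  have km: "?k \<in> borel_measurable borel"
    using m1 unfolding set_borel_measurable_def .
  have keq: "?k (case p of (r, t) \<Rightarrow> Complex r t) = 
      indicat_real ({R..} \<times> {0..<2 * pi}) p *\<^sub>R (fst p * G (polar c (fst p) (snd p)))" for p
    using assms(1) by (cases p) (auto simp: jac indicator_def S_def g_def)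
  have "integrable lborel ?k"
    by (subst lborel_complex_pair, subst integrable_distr_eq[OF cm km])
       (use set_integrable_strip[OF dom assms(1)] in \<open>simp only: keq set_integrable_def\<close>)
  then have i: "set_integrable lborel S (\<lambda>z. \<bar>area_form (g' z 1) (g' z \<i>)\<bar> * G (g z))"
    unfolding set_integrable_def .
  have e: "(LINT z:S|lborel. \<bar>area_form (g' z 1) (g' z \<i>)\<bar> * G (g z)) = strip_integral R (\<lambda>r t. r * G (polar c r t))"
    unfolding set_lebesgue_integral_def strip_integral_def
    by (subst lborel_complex_pair, subst integral_distr[OF cm km]) (simp only: keq)
  note CV = change_of_variables_complex[OF S der inj m1 m2 disjI1[OF i], unfolded im]
  show "set_integrable lborel (exterior c R) G" by (rule CV(2))
  show "(LINT y:exterior c R|lborel. G y) = strip_integral R (\<lambda>r t. r * G (polar c r t))"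
    using CV(3) e by simp
qed

section \<open>A weighted Stokes formula outside a disc\<close>

text \<open>
  The boundary of the fluid is traversed clockwise from a starting point that depends on the orientation
  of the body; by periodicity the circulation is that of the standard parametrisation.
\<close>

lemma integral_periodic_reflect_shift:
  fixes f :: "real \<Rightarrow> real"
  assumes cont: "continuous_on UNIV f" and per: "\<And>t. f (t + 2 * pi) = f t"
    and b: "0 \<le> b" "b \<le> 2 * pi"
  shows "integral {0..2 * pi} (\<lambda>t. f (b - t)) = integral {0..2 * pi} f"
proof -
  note c = continuous_on_subset[OF cont subset_UNIV]
  have "integral {0..2 * pi} (\<lambda>t. f (b - t)) = integral {- (2*pi)..- 0} (\<lambda>t. f (b - (- t)))"
    using Henstock_Kurzweil_Integration.integral_reflect_real[where f="\<lambda>t. f (b - t)" and a=0 and b="2*pi"] by simp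
  also have "\<dots> = integral {- (2*pi)..0} (f \<circ> (\<lambda>t. t + b))"
    by (simp add: o_def add.commute)
  also have "\<dots> = integral {b - 2*pi..b} f"
    using integral_shift[OF c, of "-(2*pi)" 0 b] by simp
  also have "\<dots> = integral {b - 2*pi..0} f + integral {0..b} f"
    by (rule Henstock_Kurzweil_Integration.integral_combine[symmetric])
       (use b c in \<open>auto intro: integrable_continuous_real\<close>)
  also have "integral {b - 2*pi..0} f = integral {b..2*pi} f"
    using integral_shift[OF c, of "b - 2*pi" 0 "2*pi"] by (simp add: o_def per)
  also have "integral {b..2*pi} f + integral {0..b} f = integral {0..2*pi} f"
    using Henstock_Kurzweil_Integration.integral_combine[of 0 b "2*pi" f] b c
    by (simp add: integrable_continuous_real)
  finally show ?thesis .
qed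

lemma strip_dominated_add:
  assumes "strip_dominated R K" "strip_dominated R L"
  shows "strip_dominated R (\<lambda>r t. K r t + L r t)"
proof -
  obtain C D where "\<And>r t. r \<ge> R \<Longrightarrow> t \<in> {0..2*pi} \<Longrightarrow> \<bar>K r t\<bar> \<le> C / r ^ 3" 
    "\<And>r t. r \<ge> R \<Longrightarrow> t \<in> {0..2*pi} \<Longrightarrow> \<bar>L r t\<bar> \<le> D / r ^ 3"
    using assms unfolding strip_dominated_def by blast
  then have "\<bar>K r t + L r t\<bar> \<le> (C + D) / r ^ 3" if "r \<ge> R" "t \<in> {0..2*pi}" for r t
    using that abs_triangle_ineq[of "K r t" "L r t"] unfolding add_divide_distrib by force
  with assms show ?thesis
    unfolding strip_dominated_def by (intro conjI continuous_on_add) blast+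
qed

text \<open>
  The surplus factor \<open>r ^ (n - 3)\<close> is at least \<open>R ^ (n - 3)\<close> on the strip.
\<close>

lemma strip_dominated_divide_power:
  assumes R: "0 < R" and n: "3 \<le> n"
    and cont: "continuous_on ({R..} \<times> {0..2 * pi}) (\<lambda>p. a (fst p) (snd p))"
    and bound: "\<And>r t. R \<le> r \<Longrightarrow> t \<in> {0..2*pi} \<Longrightarrow> \<bar>a r t\<bar> \<le> B"
  shows "strip_dominated R (\<lambda>r t. a r t / r ^ n)"
  unfolding strip_dominated_def
proof (intro conjI exI allI impI ballI)
  show "continuous_on ({R..} \<times> {0..2 * pi}) (\<lambda>p. a (fst p) (snd p) / fst p ^ n)"
    by (intro continuous_intros cont) (use R in auto)
  fix r t assume r: "R \<le> r" and t: "t \<in> {0..2*pi}"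
  have B: "0 \<le> B" using bound[OF r t] by linarith
  have rn: "r ^ n = r ^ 3 * r ^ (n - 3)" using n by (simp flip: power_add)
  have "\<bar>a r t / r ^ n\<bar> \<le> B / r ^ n"
    using bound[OF r t] r R by (simp add: divide_right_mono)
  also have "\<dots> = B / r ^ (n - 3) / r ^ 3" by (simp add: rn)
  also have "\<dots> \<le> B / R ^ (n - 3) / r ^ 3"
    using r R B by (intro divide_right_mono divide_left_mono power_mono mult_pos_pos) auto
  finally show "\<bar>a r t / r ^ n\<bar> \<le> (B / R ^ (n - 3)) / r ^ 3" .
qed

lemma polar_derivative_radius:
  "((\<lambda>r. polar c r t) has_derivative (\<lambda>h. of_real h * cis t)) (at r within S)"
  unfolding polar_def by (auto intro!: derivative_eq_intros)

lemma polar_derivative_angle: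
  "((\<lambda>t. polar c r t) has_derivative (\<lambda>h. h *\<^sub>R (of_real r * (\<i> * cis t)))) (at t within S)"
  unfolding polar_def by (auto intro!: derivative_eq_intros simp: scaleR_conv_of_real)

text \<open>
  The curl, the antisymmetric part of the derivative, has the same expression in every
  positively oriented orthonormal frame.
\<close>

lemma curl_frame:
  fixes D :: "complex \<Rightarrow> complex"
  assumes "linear D"
  shows "D (cis t) \<bullet> (\<i> * cis t) - D (\<i> * cis t) \<bullet> cis t = Im (D 1) - Re (D \<i>)"
proof -
  have "D (cis t) \<bullet> (\<i> * cis t) - D (\<i> * cis t) \<bullet> cis t
    = (Im (D 1) - Re (D \<i>)) * ((cos t)\<^sup>2 + (sin t)\<^sup>2)"
    unfolding linear_complex_components[OF assms, of "cis t"] linear_complex_components[OF assms, of "\<i> * cis t"]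
    by (simp add: inner_complex_def power2_eq_square algebra_simps del: sin_cos_squared_add sin_cos_squared_add2 sin_cos_squared_add3)
  then show ?thesis by simp
qed

text \<open>
  Stokes' theorem for the one-form \<open>(J / |z|\<^sup>4) u\<close> on the exterior of a disc.  With the tangential
  component \<open>p\<close>, the radial component \<open>q\<close>, and the curl expressed in the polar frame, the integrand
  \<open>r (curl u) J / r\<^sup>4\<close> equals \<open>J (\<partial>\<^sub>r (p / r\<^sup>3) + 4 p / r\<^sup>4 - (\<partial>\<^sub>t q) / r\<^sup>4)\<close>.  The
  first term leaves the circulation on the boundary, the last one integrates to zero.
\<close>

lemma weighted_stokes_exterior:
  fixes u d1 d2 :: "complex \<Rightarrow> complex" and c :: complex and R J :: real
  defines "E \<equiv> exterior c R"
    and "p \<equiv> \<lambda>r t. u (polar c r t) \<bullet> (\<i> * cis t)"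
  assumes R: "0 < R"
    and der: "\<And>y. y \<in> E \<Longrightarrow> (u has_derivative (\<lambda>h. Re h *\<^sub>R d1 y + Im h *\<^sub>R d2 y)) (at y within E)"
    and cont: "continuous_on E d1" "continuous_on E d2"
    and bound: "\<And>y. y \<in> E \<Longrightarrow> norm (u y) \<le> B" "\<And>y. y \<in> E \<Longrightarrow> norm (d1 y) \<le> B" "\<And>y. y \<in> E \<Longrightarrow> norm (d2 y) \<le> B"
  shows "(LINT y:E|lborel. (Im (d1 y) - Re (d2 y)) * (J / norm (y - c) ^ 4)) =
      strip_integral R (\<lambda>r t. 4 * J * p r t / r ^ 4) - J / R ^ 3 * integral {0..2*pi} (p R)"
    and "strip_dominated R (\<lambda>r t. 4 * J * p r t / r ^ 4)"
proof -
  let ?S = "{R..} \<times> {0..2*pi}"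
  have polE: "polar c r t \<in> E" if "R \<le> r" for r t
    using polar_exterior[OF R that] by (simp add: E_def)
  have contu: "continuous_on E u"
    using der by (meson differentiableI differentiable_imp_continuous_on differentiable_on_def)
  have comp: "continuous_on ?S (\<lambda>p. f (polar c (fst p) (snd p)))" if "continuous_on E f" for f :: "complex \<Rightarrow> complex"
    by (rule continuous_on_compose2[OF that]) (auto intro!: continuous_intros polE)
  define q where "q r t = u (polar c r t) \<bullet> cis t" for r t
  define D where "D y h = Re h *\<^sub>R d1 y + Im h *\<^sub>R d2 y" for y h
  define a where "a r t = D (polar c r t) (cis t) \<bullet> (\<i> * cis t)" for r t
  define b where "b r t = D (polar c r t) (\<i> * cis t) \<bullet> cis t" for r t
  have D: "linear (D y)" for y
    unfolding D_def by (rule linearI) (simp_all add: algebra_simps)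
  have contD: "continuous_on ?S (\<lambda>p. D (polar c (fst p) (snd p)) (f (snd p)))" if "continuous_on UNIV f" for f
    unfolding D_def using that
    by (intro continuous_intros comp cont continuous_on_compose2[OF that continuous_on_snd]) auto
  have cont_cis: "continuous_on S cis" for S by (intro continuous_intros continuous_on_id)
  have cp: "continuous_on ?S (\<lambda>x. p (fst x) (snd x))"
    unfolding p_def by (intro continuous_intros comp contu)
  have ca: "continuous_on ?S (\<lambda>x. a (fst x) (snd x))" and cb: "continuous_on ?S (\<lambda>x. b (fst x) (snd x))"
    unfolding a_def b_def by (intro continuous_intros contD)+
  have inner_bound: "\<bar>v \<bullet> w\<bar> \<le> C" if "norm v \<le> C" "norm w = 1" for v w :: complex and C
    using Cauchy_Schwarz_ineq2[of v w] that by simp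
  have bp: "\<bar>p r t\<bar> \<le> B" if "R \<le> r" for r t
    unfolding p_def by (rule inner_bound) (use bound(1) polE[OF that] in \<open>auto simp: norm_mult\<close>)
  have bD: "norm (D (polar c r t) v) \<le> 2 * B" if "R \<le> r" "norm v = 1" for r t v
  proof -
    have "norm (D (polar c r t) v) \<le> \<bar>Re v\<bar> * norm (d1 (polar c r t)) + \<bar>Im v\<bar> * norm (d2 (polar c r t))"
      using norm_triangle_ineq[of "Re v *\<^sub>R d1 (polar c r t)" "Im v *\<^sub>R d2 (polar c r t)"] by (simp add: D_def)
    also have "\<dots> \<le> 1 * B + 1 * B"
      using abs_Re_le_cmod[of v] abs_Im_le_cmod[of v] that bound(2,3)[OF polE[OF that(1)]]
      by (intro add_mono mult_mono) auto
    finally show ?thesis by simp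
  qed
  have ba: "\<bar>a r t\<bar> \<le> 2 * B" and bb: "\<bar>b r t\<bar> \<le> 2 * B" if "R \<le> r" for r t
    unfolding a_def b_def by (intro inner_bound bD that; simp add: norm_mult)+
  have radial: "((\<lambda>r. p r t) has_vector_derivative a r t) (at r within {R..})" if r: "R \<le> r" for r t
  proof -
    have "((\<lambda>r. u (polar c r t)) has_derivative (\<lambda>h. D (polar c r t) (of_real h * cis t))) (at r within {R..})"
      unfolding D_def
      by (rule has_derivative_in_compose2[OF der _ _ polar_derivative_radius]) (use r in \<open>auto intro: polE\<close>)
    then have "((\<lambda>r. p r t) has_derivative (\<lambda>h. D (polar c r t) (of_real h * cis t) \<bullet> (\<i> * cis t))) (at r within {R..})"
      unfolding p_def by (rule has_derivative_inner_left)
    moreover have "D (polar c r t) (of_real h * cis t) \<bullet> (\<i> * cis t) = h *\<^sub>R a r t" for h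
      unfolding a_def scaleR_conv_of_real[symmetric] linear_scale[OF D] by simp
    ultimately show ?thesis by (simp add: has_vector_derivative_def)
  qed
  have angular: "(q r has_vector_derivative r * b r t + p r t) (at t within {0..2*pi})"
    if r: "R \<le> r" and t: "t \<in> {0..2*pi}" for r t
  proof -
    have "((\<lambda>t. u (polar c r t)) has_derivative (\<lambda>h. D (polar c r t) (h *\<^sub>R (of_real r * (\<i> * cis t))))) (at t within {0..2*pi})"
      unfolding D_def
      by (rule has_derivative_in_compose2[OF der _ _ polar_derivative_angle]) (use r t in \<open>auto intro: polE\<close>)
    moreover have "(cis has_derivative (\<lambda>h. h *\<^sub>R (\<i> * cis t))) (at t within {0..2*pi})"
      by (rule has_derivative_cis[OF has_derivative_ident])
    ultimately have "(q r has_derivative (\<lambda>h. u (polar c r t) \<bullet> (h *\<^sub>R (\<i> * cis t))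
        + D (polar c r t) (h *\<^sub>R (of_real r * (\<i> * cis t))) \<bullet> cis t)) (at t within {0..2*pi})"
      unfolding q_def by (rule has_derivative_inner)
    moreover have "D (polar c r t) (h *\<^sub>R (of_real r * (\<i> * cis t))) \<bullet> cis t = h * (r * b r t)" for h
      unfolding b_def scaleR_conv_of_real[symmetric] linear_scale[OF D] by simp
    ultimately show ?thesis
      by (simp add: has_vector_derivative_def p_def distrib_left add.commute)
  qed
  have domp: "strip_dominated R (\<lambda>r t. k * p r t / r ^ 4)" for k
    by (rule strip_dominated_divide_power[OF R, where B="\<bar>k\<bar> * B"])
       (auto intro!: continuous_intros cp mult_left_mono bp simp: abs_mult)
  have doma: "strip_dominated R (\<lambda>r t. k * a r t / r ^ 3)" for k
    by (rule strip_dominated_divide_power[OF R, where B="\<bar>k\<bar> * (2 * B)"])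
       (auto intro!: continuous_intros ca mult_left_mono ba simp: abs_mult)
  have domb: "strip_dominated R (\<lambda>r t. k * b r t / r ^ 3)" for k
    by (rule strip_dominated_divide_power[OF R, where B="\<bar>k\<bar> * (2 * B)"])
       (auto intro!: continuous_intros cb mult_left_mono bb simp: abs_mult)
  show dom2: "strip_dominated R (\<lambda>r t. 4 * J * p r t / r ^ 4)" by (rule domp)
  note dom1 = strip_dominated_add[OF doma[of J] domp[of "- 3 * J"]]
  note dom3 = strip_dominated_add[OF domb[of "- J"] domp[of "- J"]]
  have int1: "strip_integral R (\<lambda>r t. J * a r t / r ^ 3 + - 3 * J * p r t / r ^ 4) = - integral {0..2*pi} (\<lambda>t. J * p R t / R ^ 3)"
  proof (rule strip_integral_radial_derivative[OF dom1 R, where P="\<lambda>r t. J * p r t / r ^ 3"])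
    fix t assume t: "t \<in> {0..2*pi}"
    show "((\<lambda>r. J * p r t / r ^ 3) has_vector_derivative J * a r t / r ^ 3 + - 3 * J * p r t / r ^ 4) (at r within {R..})"
      if "R \<le> r" for r
    proof -
      have d: "((\<lambda>r. p r t) has_field_derivative a r t) (at r within {R..})"
        using radial[OF that] by (simp add: has_real_derivative_iff_has_vector_derivative)
      have "((\<lambda>r. J * p r t / r ^ 3) has_field_derivative J * a r t / r ^ 3 + - 3 * J * p r t / r ^ 4) (at r within {R..})"
      proof (rule DERIV_cong)
        have "((\<lambda>r. r ^ 3) has_field_derivative 3 * r ^ 2) (at r within {R..})"
          by (auto intro!: derivative_eq_intros)
        from DERIV_divide[OF DERIV_cmult[OF d, of J] this] R that
        show "((\<lambda>r. J * p r t / r ^ 3) has_field_derivative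
            (J * a r t * r ^ 3 - J * p r t * (3 * r ^ 2)) / (r ^ 3 * r ^ 3)) (at r within {R..})"
          by simp
        have "(J * A * r ^ 3 - J * P * (3 * r ^ 2)) / (r ^ 3 * r ^ 3) = J * A / r ^ 3 + - 3 * J * P / r ^ 4" for A P
          using R that by (simp add: field_simps eval_nat_numeral)
        then show "(J * a r t * r ^ 3 - J * p r t * (3 * r ^ 2)) / (r ^ 3 * r ^ 3) = J * a r t / r ^ 3 + - 3 * J * p r t / r ^ 4" .
      qed
      then show ?thesis by (simp add: has_real_derivative_iff_has_vector_derivative)
    qed
    show "((\<lambda>r. J * p r t / r ^ 3) \<longlongrightarrow> 0) at_top"
    proof (rule Lim_null_comparison)
      show "\<forall>\<^sub>F r in at_top. norm (J * p r t / r ^ 3) \<le> \<bar>J\<bar> * B / r ^ 3"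
        using eventually_ge_at_top[of R]
      proof eventually_elim
        case (elim r)
        then show ?case using R bp[OF elim, of t]
          by (auto simp: abs_mult intro!: divide_right_mono mult_left_mono)
      qed
      show "((\<lambda>r::real. \<bar>J\<bar> * B / r ^ 3) \<longlongrightarrow> 0) at_top"
        by (intro tendsto_divide_0[OF tendsto_const] filterlim_at_top_imp_at_infinity filterlim_pow_at_top filterlim_ident) simp
    qed
  next
    have "continuous_on {0..2*pi} (\<lambda>t. p R t)"
      by (rule continuous_on_compose2[OF cp, of _ "\<lambda>t. (R, t)", simplified]) (auto intro!: continuous_intros)
    then show "continuous_on {0..2*pi} (\<lambda>t. J * p R t / R ^ 3)"
      by (intro continuous_intros) (use R in auto)
  qed
  have int3: "strip_integral R (\<lambda>r t. - J * b r t / r ^ 3 + - J * p r t / r ^ 4) = 0"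
  proof (rule strip_integral_angular_derivative[OF dom3 R, where Q="\<lambda>r t. - J / r ^ 4 * q r t"])
    fix r t assume r: "R \<le> r" and t: "t \<in> {0..2*pi}"
    have "((\<lambda>t. - J / r ^ 4 * q r t) has_vector_derivative - J / r ^ 4 * (r * b r t + p r t)) (at t within {0..2*pi})"
      by (rule has_vector_derivative_mult_right[OF angular[OF r t]])
    moreover have "- J / r ^ 4 * (r * b r t + p r t) = - J * b r t / r ^ 3 + - J * p r t / r ^ 4"
      using r R by (simp add: field_simps eval_nat_numeral)
    ultimately show "((\<lambda>t. - J / r ^ 4 * q r t) has_vector_derivative - J * b r t / r ^ 3 + - J * p r t / r ^ 4) (at t within {0..2*pi})"
      by (simp only:)
  next
    show "- J / r ^ 4 * q r (2 * pi) = - J / r ^ 4 * q r 0" for r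
      by (simp add: q_def polar_def)
  qed
  let ?G = "\<lambda>y. (Im (d1 y) - Re (d2 y)) * (J / norm (y - c) ^ 4)"
  have "(LINT y:E|lborel. ?G y) = strip_integral R (\<lambda>r t. r * ?G (polar c r t))"
    unfolding E_def
  proof (rule integral_exterior_polar(3)[OF R])
    show "continuous_on (exterior c R) ?G"
      by (intro continuous_intros cont[unfolded E_def]) (use R in \<open>auto simp: exterior_def\<close>)
    show "\<bar>?G y\<bar> \<le> (B + B) * \<bar>J\<bar> / norm (y - c) ^ 4" if y: "y \<in> exterior c R" for y
    proof -
      have "\<bar>Im (d1 y) - Re (d2 y)\<bar> \<le> B + B"
        using abs_Im_le_cmod[of "d1 y"] abs_Re_le_cmod[of "d2 y"] bound(2,3)[of y] y unfolding E_def by linarith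
      then have "\<bar>Im (d1 y) - Re (d2 y)\<bar> * (\<bar>J\<bar> / norm (y - c) ^ 4) \<le> (B + B) * (\<bar>J\<bar> / norm (y - c) ^ 4)"
        by (rule mult_right_mono) simp
      then show ?thesis by (simp add: abs_mult)
    qed
  qed
  also have "\<dots> = strip_integral R (\<lambda>r t. 4 * J * p r t / r ^ 4 + 
      ((J * a r t / r ^ 3 + - 3 * J * p r t / r ^ 4) + (- J * b r t / r ^ 3 + - J * p r t / r ^ 4)))"
  proof (rule strip_integral_cong)
    fix r t assume "R \<le> r"
    then have r: "0 < r" using R by simp
    have "Im (d1 (polar c r t)) - Re (d2 (polar c r t)) = a r t - b r t"
      using curl_frame[OF D, of "polar c r t" t] by (simp add: a_def b_def D_def)
    then have "r * ?G (polar c r t) = r * ((a r t - b r t) * (J / r ^ 4))"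
      using r by simp
    also have "\<dots> = 4 * J * p r t / r ^ 4 + 
      ((J * a r t / r ^ 3 + - 3 * J * p r t / r ^ 4) + (- J * b r t / r ^ 3 + - J * p r t / r ^ 4))"
      using r by (simp add: field_simps eval_nat_numeral)
    finally show "r * ?G (polar c r t) = 4 * J * p r t / r ^ 4 + 
      ((J * a r t / r ^ 3 + - 3 * J * p r t / r ^ 4) + (- J * b r t / r ^ 3 + - J * p r t / r ^ 4))" .
  qed
  also have "\<dots> = strip_integral R (\<lambda>r t. 4 * J * p r t / r ^ 4) + (- integral {0..2*pi} (\<lambda>t. J * p R t / R ^ 3) + 0)"
    by (subst strip_integral_add[OF dom2 strip_dominated_add[OF dom1 dom3] R], subst strip_integral_add[OF dom1 dom3 R])
       (simp only: int1 int3)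
  also have "integral {0..2*pi} (\<lambda>t. J * p R t / R ^ 3) = J / R ^ 3 * integral {0..2*pi} (p R)"
    using integral_mult_right[of "{0..2*pi}" "J / R ^ 3" "p R"] by simp
  finally show "(LINT y:E|lborel. ?G y) =
      strip_integral R (\<lambda>r t. 4 * J * p r t / r ^ 4) - J / R ^ 3 * integral {0..2*pi} (p R)"
    by simp
qed

section \<open>The fluid domain\<close>

lemma frechet_derivative_cong_within:
  assumes "x \<in> S" "\<And>y. y \<in> S \<Longrightarrow> f y = g y"
  shows "frechet_derivative f (at x within S) = frechet_derivative g (at x within S)"
proof -
  have "(f has_derivative A) (at x within S) \<longleftrightarrow> (g has_derivative A) (at x within S)" for A
    using assms by (metis has_derivative_transform)
  then show ?thesis unfolding frechet_derivative_def by simp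
qed

text \<open>
  From any point of the exterior of a disc one can move, without entering the disc, in one of the two
  directions along each coordinate axis; this determines a derivative even at the boundary.
\<close>

lemma has_derivative_exterior_unique:
  fixes f :: "complex \<Rightarrow> 'b::real_normed_vector"
  assumes x: "x \<in> exterior c R"
    and A: "(f has_derivative A) (at x within exterior c R)"
    and B: "(f has_derivative B) (at x within exterior c R)"
  shows "A = B"
proof (rule frechet_derivative_unique_within[OF A B])
  fix i :: complex and e :: real
  assume i: "i \<in> Basis" and e: "0 < e"
  define d where "d = (if (x - c) \<bullet> i < 0 then - e / 2 else e / 2)"
  have "0 \<le> d * ((x - c) \<bullet> i)"
    unfolding d_def using e mult_pos_neg[OF e, of "(x - c) \<bullet> i"]
    by (cases "(x - c) \<bullet> i < 0") auto
  moreover have "(norm (x + d *\<^sub>R i - c))\<^sup>2 = (norm (x - c))\<^sup>2 + 2 * (d * ((x - c) \<bullet> i)) + d\<^sup>2"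
    using i unfolding power2_norm_eq_inner
    by (simp add: algebra_simps inner_simps power2_eq_square inner_commute inner_Basis)
  ultimately have "(norm (x - c))\<^sup>2 \<le> (norm (x + d *\<^sub>R i - c))\<^sup>2" by simp
  then have "norm (x - c) \<le> norm (x + d *\<^sub>R i - c)" by (rule power2_le_imp_le) simp
  with x have "x + d *\<^sub>R i \<in> exterior c R" by (simp add: exterior_def)
  moreover have "0 < \<bar>d\<bar>" "\<bar>d\<bar> < e" using e by (auto simp: d_def)
  ultimately show "\<exists>d. 0 < \<bar>d\<bar> \<and> \<bar>d\<bar> < e \<and> x + d *\<^sub>R i \<in> exterior c R" by blast
qed

lemma frechet_derivative_exterior:
  fixes f :: "complex \<Rightarrow> 'b::real_normed_vector"
  assumes "x \<in> exterior c R" "(f has_derivative A) (at x within exterior c R)"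
  shows "frechet_derivative f (at x within exterior c R) = A"
  using has_derivative_exterior_unique[OF assms(1) _ assms(2)] assms(2)
  by (metis differentiableI frechet_derivative_works)

lemma exterior_eq_Compl: "exterior c R = - ball c R"
  by (auto simp: exterior_def dist_norm norm_minus_commute)

lemma fluid0_eq: "0 < R \<Longrightarrow> fluid0 R = exterior 0 R"
  by (simp add: fluid0_def body0_def closure_complement exterior_eq_Compl)

lemma frontier_exterior: "0 < R \<Longrightarrow> frontier (exterior c R) = sphere c R"
  by (simp add: exterior_eq_Compl frontier_complement)

lemma smooth_on_differentiable: "smooth_on S f \<Longrightarrow> f differentiable_on S"
  unfolding smooth_on_def by (metis iter_deriv.simps(1))

lemma smooth_on_differentiable_deriv:
  "smooth_on S f \<Longrightarrow> (\<lambda>x. frechet_derivative f (at x within S) v) differentiable_on S"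
  unfolding smooth_on_def by (metis iter_deriv.simps)

lemma smooth_on_has_derivative:
  "smooth_on S f \<Longrightarrow> x \<in> S \<Longrightarrow> (f has_derivative frechet_derivative f (at x within S)) (at x within S)"
  using smooth_on_differentiable frechet_derivative_works unfolding differentiable_on_def by blast

text \<open>
  These bounds dominate the integrands below, because every one of them carries an explicit factor
  \<open>|z|\<^sup>-\<^sup>4\<close> or \<open>|z|\<^sup>-\<^sup>5\<close>.
\<close>

lemma smooth_decaying_bounded:
  assumes "smooth_decaying k S f"
  shows "\<exists>B. \<forall>x\<in>S. norm (iter_deriv S vs f x) \<le> B"
proof -
  obtain C where C: "\<And>x. x \<in> S \<Longrightarrow> norm (iter_deriv S vs f x) \<le> C / (1 + norm x) ^ k"
    using assms unfolding smooth_decaying_def by blast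
  have "norm (iter_deriv S vs f x) \<le> \<bar>C\<bar>" if "x \<in> S" for x
  proof -
    have 1: "1 \<le> (1 + norm x) ^ k" by (simp add: one_le_power)
    have "C \<le> \<bar>C\<bar> * (1 + norm x) ^ k"
      using mult_left_mono[OF 1, of "\<bar>C\<bar>"] by linarith
    then have "C / (1 + norm x) ^ k \<le> \<bar>C\<bar>" using 1 by (subst pos_divide_le_eq) linarith+
    with C[OF that] show ?thesis by linarith
  qed
  then show ?thesis by blast
qed

text \<open>
  The image of the open exterior is open by invariance of domain, connected, and disjoint from the image of
  the boundary.  Being unbounded, it lies outside the circle, and it is relatively closed there
  because the whole image is closed; so it is everything outside the circle.
\<close>

lemma image_exterior_of_proper_embedding:
  fixes \<phi> :: "complex \<Rightarrow> complex"
  assumes R: "0 < R" 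
    and cont: "continuous_on (exterior 0 R) \<phi>" and inj: "inj_on \<phi> (exterior 0 R)"
    and near: "\<And>x. x \<in> exterior 0 R \<Longrightarrow> norm (\<phi> x - x) \<le> B"
    and bd: "\<phi> ` sphere 0 R = sphere c R"
  shows "\<phi> ` exterior 0 R = exterior c R"
proof -
  let ?E = "exterior 0 R" and ?O = "- cball (0::complex) R" and ?X = "- cball c R"
  have E: "?E = ?O \<union> sphere 0 R" 
    by (auto simp: exterior_def)
  have X: "exterior c R = ?X \<union> sphere c R"
    by (auto simp: exterior_def dist_norm norm_minus_commute)
  have opn: "open (\<phi> ` ?O)"
    by (intro invariance_of_domain continuous_on_subset[OF cont] inj_on_subset[OF inj]) (auto simp: E)
  have conn: "connected (\<phi> ` ?O)"
    by (intro connected_continuous_image continuous_on_subset[OF cont] connected_complement_bounded_convex)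
       (auto simp: E)
  have disj: "\<phi> ` ?O \<inter> sphere c R = {}"
    unfolding bd[symmetric]
    by (subst inj_on_image_Int[OF inj, symmetric]) (auto simp: E)
  have "\<not> \<phi> ` ?O \<subseteq> ball c R"
  proof
    assume sub: "\<phi> ` ?O \<subseteq> ball c R"
    \<comment> \<open>A point so far out that its image cannot lie in the ball.\<close>
    define x where "x = complex_of_real (R + norm c + \<bar>B\<bar> + R + 1)"
    have nx: "norm x = R + norm c + \<bar>B\<bar> + R + 1" unfolding x_def using R by (simp del: of_real_add of_real_1)
    then have xO: "x \<in> ?O" using R norm_ge_zero[of c] abs_ge_zero[of B] by (simp del: norm_ge_zero abs_ge_zero)
    then have "norm (\<phi> x - c) < R"
      using subsetD[OF sub imageI[OF xO]] by (simp add: dist_norm norm_minus_commute)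
    moreover have "norm (\<phi> x - x) \<le> B" using near xO E by blast
    moreover have "norm x \<le> norm (\<phi> x - c) + norm c + norm (\<phi> x - x)"
      using norm_triangle_ineq4[of "\<phi> x - c" "\<phi> x - x"] norm_triangle_ineq[of "(\<phi> x - c) - (\<phi> x - x)" c] by simp
    ultimately show False using nx R by linarith
  qed
  have "y \<in> ball c R \<union> ?X" if "y \<in> \<phi> ` ?O" for y
  proof -
    have "y \<notin> sphere c R" using that disj by blast
    then show ?thesis by auto
  qed
  then have cover: "\<phi> ` ?O \<subseteq> ball c R \<union> ?X" by blast
  have "ball c R \<inter> ?X \<inter> \<phi> ` ?O = {}" using ball_subset_cball by blast
  from connectedD[OF conn open_ball open_Compl[OF closed_cball] this cover]
  have "ball c R \<inter> \<phi> ` ?O = {} \<or> ?X \<inter> \<phi> ` ?O = {}" .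
  with cover \<open>\<not> \<phi> ` ?O \<subseteq> ball c R\<close> have sub: "\<phi> ` ?O \<subseteq> ?X" by blast
  have closed: "closed (\<phi> ` ?E)"
    unfolding closed_sequential_limits
  proof (intro allI impI, elim conjE)
    fix y l assume y: "\<forall>n. y n \<in> \<phi> ` ?E" and l: "y \<longlonglongrightarrow> l"
    then have "\<forall>n. \<exists>x. x \<in> ?E \<and> y n = \<phi> x" by blast
    from choice[OF this] obtain x where x: "\<And>n. x n \<in> ?E" "\<And>n. y n = \<phi> (x n)" by blast
    obtain b where b: "\<And>n. norm (y n) \<le> b"
      using convergent_imp_bounded[OF l] by (auto simp: bounded_iff)
    let ?K = "?E \<inter> cball 0 (b + B)"
    have "x n \<in> ?K" for n
      using x(1)[of n] near[OF x(1)[of n]] b[of n] norm_triangle_ineq4[of "\<phi> (x n)" "\<phi> (x n) - x n"]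
      by (simp flip: x(2))
    then have yK: "\<forall>n. y n \<in> \<phi> ` ?K" using x(2) by auto
    have "compact (\<phi> ` ?K)"
      by (intro compact_continuous_image continuous_on_subset[OF cont] closed_Int_compact) auto
    then have "l \<in> \<phi> ` ?K"
      using yK l compact_imp_closed closed_sequential_limits by blast
    then show "l \<in> \<phi> ` ?E" by blast
  qed
  have "\<phi> ` ?O = \<phi> ` ?E \<inter> ?X"
  proof (intro equalityI subsetI)
    fix y assume "y \<in> \<phi> ` ?E \<inter> ?X"
    then obtain x where x: "x \<in> ?E" "y = \<phi> x" "\<phi> x \<notin> sphere c R" by auto
    then have "x \<notin> sphere 0 R" unfolding bd[symmetric] by blast
    with x show "y \<in> \<phi> ` ?O" unfolding E by blast
  qed (use sub E in blast)
  then have "closedin (top_of_set ?X) (\<phi> ` ?O)"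
    using closedin_closed_Int[OF closed, of ?X] by (simp add: Int_commute)
  moreover have "openin (top_of_set ?X) (\<phi> ` ?O)"
    by (rule open_subset[OF sub opn])
  moreover have "connected ?X"
    by (rule connected_complement_bounded_convex) auto
  moreover have "\<phi> ` ?O \<noteq> {}"
  proof -
    have "complex_of_real (R + 1) \<in> ?O" using R by (simp del: of_real_add)
    then show ?thesis by blast
  qed
  ultimately have "\<phi> ` ?O = ?X"
    using connected_clopen[of ?X] by blast
  then show ?thesis unfolding E X image_Un bd by simp
qed

lemma se2_act_sphere: "g \<in> SE2 \<Longrightarrow> se2_act g ` sphere 0 R = sphere (snd g) R"
proof (intro equalityI subsetI)
  assume "g \<in> SE2"
  then obtain b where b: "fst g = cis b" unfolding SE2_def by auto
  fix y assume "y \<in> sphere (snd g) R"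
  then have "y = se2_act g (cis (- b) * (y - snd g))" "cis (- b) * (y - snd g) \<in> sphere 0 R"
    by (auto simp: se2_act_def b norm_mult dist_norm norm_minus_commute cis_mult simp flip: mult.assoc)
  then show "y \<in> se2_act g ` sphere 0 R" by blast
qed (auto simp: SE2_def se2_act_def norm_mult dist_norm)

text \<open>
  What is needed of a configuration: its fluid domain is the exterior of the displaced disc, its embedding has
  a continuous inverse and a bounded derivative, and it preserves area.
\<close>

lemma config_space_geometry:
  assumes q: "q \<in> config_space R" and R: "0 < R"
  shows "smooth_on (exterior 0 R) (snd q)"
    and "inj_on (snd q) (exterior 0 R)"
    and "snd q ` exterior 0 R = exterior (snd (fst q)) R"
    and "fluid R q = exterior (snd (fst q)) R"
    and "\<exists>b. fst (fst q) = cis b"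
    and "continuous_on (exterior (snd (fst q)) R) (inv_into (exterior 0 R) (snd q))"
    and "\<exists>B. \<forall>x\<in>exterior 0 R. \<forall>v. norm (frechet_derivative (snd q) (at x within exterior 0 R) v) \<le> B * norm v"
    and "\<And>x v w. x \<in> exterior 0 R \<Longrightarrow> area_form (frechet_derivative (snd q) (at x within exterior 0 R) v)
                    (frechet_derivative (snd q) (at x within exterior 0 R) w) = area_form v w"
proof -
  obtain g \<phi> where qe: "q = (g, \<phi>)" by (cases q)
  let ?E = "exterior 0 R"
  have f0: "fluid0 R = ?E" using fluid0_eq[OF R] .
  have g: "g \<in> SE2" and emb: "smooth_embedding ?E \<phi>" 
    and area: "\<And>x v w. x \<in> ?E \<Longrightarrow> area_form (frechet_derivative \<phi> (at x within ?E) v)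
                    (frechet_derivative \<phi> (at x within ?E) w) = area_form v w"
    and dec: "smooth_decaying 2 ?E (\<lambda>x. \<phi> x - x)"
    and bd: "\<phi> ` frontier ?E = se2_act g ` frontier (body0 R)"
    using q unfolding config_space_def qe f0 by auto
  show sm: "smooth_on ?E (snd q)" using emb by (simp add: smooth_embedding_def qe)
  obtain \<psi> where hom: "homeomorphism ?E (\<phi> ` ?E) \<phi> \<psi>"
    using emb by (auto simp: smooth_embedding_def)
  have inj: "inj_on \<phi> ?E" by (rule inj_on_inverseI) (rule homeomorphism_apply1[OF hom])
  then show "inj_on (snd q) ?E" by (simp add: qe)
  have cont: "continuous_on ?E \<phi>" using hom by (rule homeomorphism_cont1)
  have bd': "\<phi> ` sphere 0 R = sphere (snd g) R"
    using bd se2_act_sphere[OF g] by (simp add: frontier_exterior R body0_def)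
  obtain C where C: "\<And>x. x \<in> ?E \<Longrightarrow> norm (\<phi> x - x) \<le> C"
    using smooth_decaying_bounded[OF dec, of "[]"] by auto
  have im: "\<phi> ` ?E = exterior (snd g) R"
    by (rule image_exterior_of_proper_embedding[OF R cont inj C bd'])
  then show "snd q ` ?E = exterior (snd (fst q)) R" "fluid R q = exterior (snd (fst q)) R"
    by (simp_all add: qe fluid_def f0)
  show "\<exists>b. fst (fst q) = cis b" using g by (auto simp: qe SE2_def)
  have "continuous_on (exterior (snd g) R) (inv_into ?E \<phi>)"
  proof (rule continuous_on_eq)
    show "continuous_on (exterior (snd g) R) \<psi>" using homeomorphism_cont2[OF hom] im by simp
    fix y assume "y \<in> exterior (snd g) R"
    then obtain x where x: "x \<in> ?E" "y = \<phi> x" using im by blast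
    then show "\<psi> y = inv_into ?E \<phi> y" using homeomorphism_apply1[OF hom x(1)] inv_into_f_f[OF inj x(1)] by simp
  qed
  then show "continuous_on (exterior (snd (fst q)) R) (inv_into ?E (snd q))" by (simp add: qe)
  show "area_form (frechet_derivative (snd q) (at x within ?E) v)
                    (frechet_derivative (snd q) (at x within ?E) w) = area_form v w" if "x \<in> ?E" for x v w
    using area[OF that] by (simp add: qe)
  define D where "D x = frechet_derivative \<phi> (at x within ?E)" for x
  have Dx: "(\<phi> has_derivative D x) (at x within ?E)" if "x \<in> ?E" for x
    unfolding D_def using smooth_on_has_derivative[OF sm that] by (simp add: qe)
  have Dd: "frechet_derivative (\<lambda>x. \<phi> x - x) (at x within ?E) = (\<lambda>v. D x v - v)" if "x \<in> ?E" for x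
    by (rule frechet_derivative_exterior[OF that]) (intro derivative_intros Dx that)
  have "\<exists>K. \<forall>x\<in>?E. norm (D x v - v) \<le> K" for v
    using smooth_decaying_bounded[OF dec, of "[v]"] by (simp add: Dd)
  then obtain K where K: "\<And>v x. x \<in> ?E \<Longrightarrow> norm (D x v - v) \<le> K v" by metis
  define B where "B = (K 1 + 1) + (K \<i> + 1)"
  have "norm (D x v) \<le> B * norm v" if x: "x \<in> ?E" for x v
  proof -
    have 1: "norm (D x w) \<le> K w + norm w" for w
      using K[OF x, of w] norm_triangle_sub[of "D x w" w] by linarith
    have "norm (D x v) \<le> \<bar>Re v\<bar> * norm (D x 1) + \<bar>Im v\<bar> * norm (D x \<i>)"
      unfolding linear_complex_components[OF has_derivative_linear[OF Dx[OF x]], of v]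
      using norm_triangle_ineq[of "Re v *\<^sub>R D x 1" "Im v *\<^sub>R D x \<i>"] by simp
    also have "\<dots> \<le> norm v * (K 1 + 1) + norm v * (K \<i> + 1)"
      using 1[of 1] 1[of \<i>] by (intro add_mono mult_mono) (auto simp: abs_Re_le_cmod abs_Im_le_cmod)
    finally show ?thesis by (simp add: B_def algebra_simps)
  qed
  then show "\<exists>B. \<forall>x\<in>?E. \<forall>v. norm (frechet_derivative (snd q) (at x within ?E) v) \<le> B * norm v"
    unfolding D_def qe by auto
qed

section \<open>The Neumann problem outside a disc\<close>

lemma second_derivative_at_max_nonpos:
  fixes k :: "real \<Rightarrow> real"
  assumes e: "0 < e"
    and k: "\<And>t. \<bar>t\<bar> < e \<Longrightarrow> (k has_real_derivative k' t) (at t)"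
    and k': "(k' has_real_derivative L) (at 0)"
    and max: "\<And>t. \<bar>t\<bar> < e \<Longrightarrow> k t \<le> k 0"
  shows "L \<le> 0"
proof (rule ccontr)
  assume "\<not> L \<le> 0"
  then have L: "0 < L" by simp
  have "k' 0 = 0"
    using DERIV_local_max[OF k[of 0] e] max e by simp
  then obtain d where d: "0 < d" "\<And>h. 0 < h \<Longrightarrow> h < d \<Longrightarrow> 0 < k' h"
    using has_real_derivative_pos_inc_right[OF k' L] by auto
  define t where "t = min d e / 2"
  have t: "0 < t" "t < d" "t < e" using d(1) e by (simp_all add: t_def min_def)
  obtain z where "0 < z" "z < t" "k t - k 0 = (t - 0) * k' z"
    using MVT2[OF t(1), of k k'] k t by force
  moreover have "0 < (t - 0) * k' z" using d(2) calculation t by simp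
  ultimately show False using max[of t] t by simp
qed

lemma has_real_derivative_along_line:
  fixes f :: "complex \<Rightarrow> real"
  assumes "(f has_derivative D) (at (m + t *\<^sub>R v) within (\<lambda>t. m + t *\<^sub>R v) ` T)"
  shows "((\<lambda>t. f (m + t *\<^sub>R v)) has_real_derivative D v) (at t within T)"
proof -
  have "((\<lambda>t. m + t *\<^sub>R v) has_derivative (\<lambda>h. h *\<^sub>R v)) (at t within T)"
    by (auto intro!: derivative_eq_intros)
  from diff_chain_within[OF this assms]
  have "((\<lambda>t. f (m + t *\<^sub>R v)) has_derivative (\<lambda>h. D (h *\<^sub>R v))) (at t within T)"
    by (simp add: o_def)
  moreover have "(\<lambda>h. D (h *\<^sub>R v)) = (*) (D v)"
    using linear_scale[OF has_derivative_linear[OF assms], of _ v] by (auto simp: mult.commute)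
  ultimately show ?thesis by (simp add: has_field_derivative_def)
qed

lemma grad_inner:
  assumes "(f has_derivative D) (at x within S)" "frechet_derivative f (at x within S) = D"
  shows "grad S f x \<bullet> v = D v"
proof -
  have "D v = Re v *\<^sub>R D 1 + Im v *\<^sub>R D \<i>"
    by (rule linear_complex_components[OF has_derivative_linear[OF assms(1)]])
  then show ?thesis by (simp add: grad_def assms(2) inner_complex_def mult.commute)
qed

text \<open>
  Maximum principle.  The term \<open>\<epsilon> |x - c|\<^sup>2\<close> is strictly subharmonic with positive radial
  derivative, so after adding it to \<open>f - g\<close> the maximum over an annulus is attained neither in the
  interior nor on the inner circle.  On a large outer circle \<open>f - g\<close> is small, and then \<open>\<epsilon>\<close> tends to zero.
\<close>

lemma neumann_comparison:
  fixes f g :: "complex \<Rightarrow> real" and c :: complex and R :: real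
  defines "E \<equiv> exterior c R"
  assumes R: "0 < R" and f: "smooth_on E f" and g: "smooth_on E g"
    and lap: "\<And>x. x \<in> E \<Longrightarrow> laplacian E f x = laplacian E g x"
    and bd: "\<And>x. x \<in> sphere c R \<Longrightarrow> grad E f x \<bullet> (x - c) = grad E g x \<bullet> (x - c)"
    and inf: "((\<lambda>x. f x - g x) \<longlongrightarrow> 0) (inf at_infinity (principal E))"
    and x: "x \<in> E"
  shows "f x \<le> g x"
proof -
  let ?D = "\<lambda>f x. frechet_derivative f (at x within E)"
  have Df: "(f has_derivative ?D f y) (at y within E)" if "y \<in> E" for y
    using smooth_on_has_derivative[OF f that] .
  have Dg: "(g has_derivative ?D g y) (at y within E)" if "y \<in> E" for y
    using smooth_on_has_derivative[OF g that] .
  have "f x - g x \<le> \<delta>" if \<delta>: "0 < \<delta>" for \<delta>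
  proof -
    have "\<forall>\<^sub>F y in inf at_infinity (principal E). \<bar>f y - g y\<bar> < \<delta>"
      using tendstoD[OF inf \<delta>] by (simp add: dist_real_def)
    then obtain b where b: "\<And>y. y \<in> E \<Longrightarrow> b \<le> norm y \<Longrightarrow> \<bar>f y - g y\<bar> < \<delta>"
      unfolding eventually_inf_principal eventually_at_infinity by blast
    \<comment> \<open>The radius is chosen so that the point lies in the annulus and the outer circle is beyond the bound \<open>b\<close>.\<close>
    define \<rho> where "\<rho> = \<bar>b\<bar> + norm c + norm (x - c)"
    have \<rho>: "norm (x - c) \<le> \<rho>" "\<And>y. norm (y - c) = \<rho> \<Longrightarrow> b \<le> norm y"
    proof -
      show "norm (x - c) \<le> \<rho>" by (simp add: \<rho>_def)
      fix y assume "norm (y - c) = \<rho>"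
      moreover have "norm (y - c) \<le> norm y + norm c" by (rule norm_triangle_ineq4)
      ultimately show "b \<le> norm y" using norm_ge_zero[of "x - c"] unfolding \<rho>_def by linarith
    qed
    have key: "f x - g x \<le> \<delta> + \<epsilon> * \<rho>\<^sup>2" if \<epsilon>: "0 < \<epsilon>" for \<epsilon>
    proof -
      define h where "h y = f y - g y + \<epsilon> * ((y - c) \<bullet> (y - c))" for y
      define A where "A = {y. R \<le> norm (y - c) \<and> norm (y - c) \<le> \<rho>}"
      have AE: "A \<subseteq> E" by (auto simp: A_def E_def exterior_def)
      have "A = cball c \<rho> \<inter> E" by (auto simp: A_def E_def exterior_def dist_norm norm_minus_commute)
      then have "compact A" by (auto simp: E_def intro!: compact_Int_closed)
      moreover have xA: "x \<in> A" using x \<rho>(1) by (simp add: A_def E_def exterior_def)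
      moreover have "continuous_on A h"
        unfolding h_def using smooth_on_differentiable[OF f] smooth_on_differentiable[OF g] AE
        by (intro continuous_intros) (auto intro: continuous_on_subset differentiable_imp_continuous_on)
      ultimately obtain m where m: "m \<in> A" "\<And>y. y \<in> A \<Longrightarrow> h y \<le> h m"
        using continuous_attains_sup[of A h] by blast
      have mE: "m \<in> E" using m AE by blast
      consider "norm (m - c) = \<rho>" | "norm (m - c) = R" "R < \<rho>" | "R < norm (m - c)" "norm (m - c) < \<rho>"
        using m(1) unfolding A_def by fastforce
      then have "h m \<le> \<delta> + \<epsilon> * \<rho>\<^sup>2"
      proof cases
        case 1
        then have "f m - g m < \<delta>" using b[OF mE \<rho>(2)] by simp
        then show ?thesis using 1 by (simp add: h_def flip: power2_norm_eq_inner)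
      next
        case 2
        \<comment> \<open>A maximum on the inner circle is excluded by the positive one-sided derivative in the direction away from the disc.\<close>
        let ?v = "m - c" and ?T = "{0..(\<rho> - R) / R}"
        have in_A: "m + t *\<^sub>R ?v \<in> A" if "t \<in> ?T" for t
        proof -
          have "m + t *\<^sub>R ?v - c = (1 + t) *\<^sub>R ?v" by (simp add: algebra_simps)
          then have "norm (m + t *\<^sub>R ?v - c) = (1 + t) * R" using that 2 by simp
          moreover have "R \<le> (1 + t) * R" "(1 + t) * R \<le> \<rho>"
            using that R by (auto simp: field_simps)
          ultimately show ?thesis by (simp add: A_def)
        qed
        have sub: "(\<lambda>t. m + t *\<^sub>R ?v) ` ?T \<subseteq> E" using in_A AE by blast
        have "(h has_derivative (\<lambda>v. ?D f m v - ?D g m v + \<epsilon> * (2 * ((m - c) \<bullet> v)))) (at m within E)"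
          unfolding h_def by (auto intro!: derivative_eq_intros Df Dg mE simp: inner_commute)
        then have "(h has_derivative (\<lambda>v. ?D f m v - ?D g m v + \<epsilon> * (2 * ((m - c) \<bullet> v)))) 
            (at (m + 0 *\<^sub>R ?v) within (\<lambda>t. m + t *\<^sub>R ?v) ` ?T)"
          using has_derivative_subset[OF _ sub] by simp
        from has_real_derivative_along_line[OF this]
        have "((\<lambda>t. h (m + t *\<^sub>R ?v)) has_real_derivative \<epsilon> * (2 * R\<^sup>2)) (at 0 within ?T)"
          using bd[of m] 2 grad_inner[OF Df[OF mE] refl] grad_inner[OF Dg[OF mE] refl]
          by (simp add: dist_norm norm_minus_commute flip: power2_norm_eq_inner)
        moreover have "0 < \<epsilon> * (2 * R\<^sup>2)" using \<epsilon> R by simp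
        ultimately obtain d where d: "0 < d" 
          "\<And>t. 0 < t \<Longrightarrow> 0 + t \<in> ?T \<Longrightarrow> t < d \<Longrightarrow> h (m + 0 *\<^sub>R ?v) < h (m + (0 + t) *\<^sub>R ?v)"
          using has_real_derivative_pos_inc_right by blast
        define t where "t = min (d / 2) ((\<rho> - R) / R)"
        have "0 < t" "t \<in> ?T" "t < d" using d(1) 2 R by (auto simp: t_def)
        with d(2)[of t] m(2)[OF in_A[of t]] show ?thesis by simp
      next
        case 3
        let ?U = "{y. R < norm (y - c) \<and> norm (y - c) < \<rho>}"
        have oU: "open ?U"
          by (intro open_Collect_conj open_Collect_less continuous_intros)
        have UE: "?U \<subseteq> E" "?U \<subseteq> A" by (auto simp: E_def exterior_def A_def)
        have atU: "at y within E = at y" if "y \<in> ?U" for y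
          using at_within_open_subset[OF that oU UE(1)] .
        obtain e where e: "0 < e" "ball m e \<subseteq> ?U"
          using oU 3 open_contains_ball by blast
        \<comment> \<open>In the interior both second directional derivatives would be nonpositive, against a Laplacian of \<open>4 \<epsilon>\<close>.\<close>
        have dir: "iter_deriv E [v, v] f m - iter_deriv E [v, v] g m + 2 * \<epsilon> \<le> 0" if v: "norm v = 1" for v
        proof (rule second_derivative_at_max_nonpos[OF e(1)])
          have inU: "m + t *\<^sub>R v \<in> ?U" if "\<bar>t\<bar> < e" for t
            using that v by (intro subsetD[OF e(2)]) (simp add: dist_norm)
          fix t :: real assume t: "\<bar>t\<bar> < e"
          let ?p = "m + t *\<^sub>R v"
          have pE: "?p \<in> E" and pA: "?p \<in> A" using inU[OF t] UE by blast+
          have "(h has_derivative (\<lambda>w. ?D f ?p w - ?D g ?p w + \<epsilon> * (2 * ((?p - c) \<bullet> w)))) (at ?p within E)"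
            unfolding h_def by (auto intro!: derivative_eq_intros Df Dg pE simp: inner_commute)
          then have "(h has_derivative (\<lambda>w. ?D f ?p w - ?D g ?p w + \<epsilon> * (2 * ((?p - c) \<bullet> w)))) 
              (at ?p within (\<lambda>t. m + t *\<^sub>R v) ` UNIV)"
            unfolding atU[OF inU[OF t]] by (rule has_derivative_at_withinI)
          from has_real_derivative_along_line[OF this]
          show "((\<lambda>t. h (m + t *\<^sub>R v)) has_real_derivative 
            (\<lambda>t. ?D f (m + t *\<^sub>R v) v - ?D g (m + t *\<^sub>R v) v + \<epsilon> * (2 * ((m - c) \<bullet> v + t))) t) (at t)"
            using v by (simp add: inner_simps dot_square_norm) (simp add: algebra_simps)
          show "h (m + t *\<^sub>R v) \<le> h (m + 0 *\<^sub>R v)" using m(2)[OF pA] by simp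
        next
          have iter: "((\<lambda>x. ?D F x v) has_derivative ?D (\<lambda>x. ?D F x v) m) (at m)" if "smooth_on E F" for F :: "complex \<Rightarrow> real"
            using smooth_on_differentiable_deriv[OF that, of v] mE 3 atU[of m]
            unfolding differentiable_on_def frechet_derivative_works by (metis (mono_tags, lifting) mem_Collect_eq)
          have line: "((\<lambda>t. ?D F (m + t *\<^sub>R v) v) has_real_derivative iter_deriv E [v, v] F m) (at 0)" if "smooth_on E F" for F :: "complex \<Rightarrow> real"
          proof -
            have "((\<lambda>x. ?D F x v) has_derivative ?D (\<lambda>x. ?D F x v) m) (at (m + 0 *\<^sub>R v) within (\<lambda>t. m + t *\<^sub>R v) ` UNIV)"
              using has_derivative_at_withinI[OF iter[OF that]] by simp
            from has_real_derivative_along_line[OF this] show ?thesis by simp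
          qed
          show "((\<lambda>t. ?D f (m + t *\<^sub>R v) v - ?D g (m + t *\<^sub>R v) v + \<epsilon> * (2 * ((m - c) \<bullet> v + t)))
            has_real_derivative iter_deriv E [v, v] f m - iter_deriv E [v, v] g m + 2 * \<epsilon>) (at 0)"
            by (rule derivative_eq_intros line f g refl | simp)+
        qed
        have "0 \<le> - 4 * \<epsilon>"
          using dir[of 1] dir[of \<i>] lap[OF mE] unfolding laplacian_def by simp
        with \<epsilon> show ?thesis by simp
      qed
      moreover have "f x - g x \<le> h x" using \<epsilon> by (simp add: h_def)
      ultimately show ?thesis using m(2)[OF xA] by simp
    qed
    show "f x - g x \<le> \<delta>"
    proof (rule field_le_epsilon)
      fix e :: real assume e: "0 < e"
      have "f x - g x \<le> \<delta> + e / (\<rho>\<^sup>2 + 1) * \<rho>\<^sup>2"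
        by (rule key) (use e in \<open>simp add: add_nonneg_pos\<close>)
      also have "e / (\<rho>\<^sup>2 + 1) * \<rho>\<^sup>2 \<le> e / (\<rho>\<^sup>2 + 1) * (\<rho>\<^sup>2 + 1)"
        using e by (intro mult_left_mono) auto
      also have "\<dots> = e"
      proof -
        have "\<rho>\<^sup>2 + 1 \<noteq> 0" using zero_le_power2[of \<rho>] by linarith
        then show ?thesis by simp
      qed
      finally show "f x - g x \<le> \<delta> + e" by simp
    qed
  qed
  then have "f x - g x \<le> 0" using field_le_epsilon[of "f x - g x" 0] by simp
  then show ?thesis by simp
qed

text \<open>
  The potential of the flow around a disc of radius \<open>R\<close> that moves with velocity \<open>V\<close>.
\<close>

definition dipole :: "complex \<Rightarrow> real \<Rightarrow> complex \<Rightarrow> complex \<Rightarrow> real" where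
  "dipole c R V x = - (R\<^sup>2) * Re (V / (x - c))"

text \<open>
  The velocity is the complex conjugate of the derivative of the complex potential
  \<open>- R\<^sup>2 V / (x - c)\<close>.
\<close>

definition dipole_velocity :: "complex \<Rightarrow> real \<Rightarrow> complex \<Rightarrow> complex \<Rightarrow> complex" where
  "dipole_velocity c R V x = cnj (complex_of_real (R\<^sup>2) * V / (x - c) ^ 2)"

lemma has_derivative_Re_inverse_power:
  assumes "x \<noteq> c"
  shows "((\<lambda>x. Re (a / (x - c) ^ n)) has_derivative (\<lambda>h. Re (- (of_nat n * a * h) / (x - c) ^ Suc n))) (at x within S)"
proof -
  have "((\<lambda>x. a / (x - c) ^ n) has_field_derivative - (of_nat n * a) / (x - c) ^ Suc n) (at x within S)"
  proof -
    define z where "z = x - c"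
    have z: "z \<noteq> 0" using assms by (simp add: z_def)
    have "((\<lambda>x. a / (x - c) ^ n) has_field_derivative
        (0 * z ^ n - a * (of_nat n * (1 - 0) * z ^ (n - 1))) / (z ^ n * z ^ n)) (at x within S)"
      unfolding z_def by (rule derivative_eq_intros refl | use assms in simp)+
    moreover have "(0 * z ^ n - a * (of_nat n * (1 - 0) * z ^ (n - 1))) / (z ^ n * z ^ n) = - (of_nat n * a) / z ^ Suc n"
      using z by (cases n) (simp_all add: field_simps)
    ultimately show ?thesis by (simp only: z_def)
  qed
  then have "((\<lambda>x. a / (x - c) ^ n) has_derivative (\<lambda>h. - (of_nat n * a) / (x - c) ^ Suc n * h)) (at x within S)"
    unfolding has_field_derivative_def .
  from has_derivative_compose[OF this bounded_linear_imp_has_derivative[OF bounded_linear_Re]]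
  show ?thesis by (simp only: times_divide_eq_left mult_minus_left)
qed

lemma frechet_Re_inverse_power:
  assumes R: "0 < R" and x: "x \<in> exterior c R"
    and f: "\<And>y. y \<in> exterior c R \<Longrightarrow> f y = Re (a / (y - c) ^ n)"
  shows "(f has_derivative (\<lambda>h. Re (- (of_nat n * a * h) / (x - c) ^ Suc n))) (at x within exterior c R)"
    and "frechet_derivative f (at x within exterior c R) = (\<lambda>h. Re (- (of_nat n * a * h) / (x - c) ^ Suc n))"
proof -
  have "x \<noteq> c" using x R by (auto simp: exterior_def)
  from has_derivative_transform[OF x f has_derivative_Re_inverse_power[OF this]]
  show d: "(f has_derivative (\<lambda>h. Re (- (of_nat n * a * h) / (x - c) ^ Suc n))) (at x within exterior c R)" .
  show "frechet_derivative f (at x within exterior c R) = (\<lambda>h. Re (- (of_nat n * a * h) / (x - c) ^ Suc n))"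
    by (rule frechet_derivative_exterior[OF x d])
qed

text \<open>
  Functions of this shape are closed under directional derivatives, which proves smoothness
  by induction on the list of directions.
\<close>

lemma iter_deriv_Re_inverse_power:
  assumes R: "0 < R" and "\<And>y. y \<in> exterior c R \<Longrightarrow> f y = Re (a / (y - c) ^ n)"
  shows "\<exists>a n. \<forall>y\<in>exterior c R. iter_deriv (exterior c R) vs f y = Re (a / (y - c) ^ n)"
  using assms(2)
proof (induction vs arbitrary: f a n)
  case (Cons v vs)
  have "frechet_derivative f (at y within exterior c R) v = Re (- (of_nat n * a * v) / (y - c) ^ Suc n)"
    if "y \<in> exterior c R" for y
    using frechet_Re_inverse_power(2)[OF R that Cons.prems] by simp
  from Cons.IH[OF this] show ?case by simp
qed auto

lemma smooth_on_Re_inverse_power: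
  assumes R: "0 < R" and f: "\<And>y. y \<in> exterior c R \<Longrightarrow> f y = Re (a / (y - c) ^ n)"
  shows "smooth_on (exterior c R) f"
  unfolding smooth_on_def differentiable_on_def
proof (intro allI ballI)
  fix vs x assume x: "x \<in> exterior c R"
  obtain a n where "\<And>y. y \<in> exterior c R \<Longrightarrow> iter_deriv (exterior c R) vs f y = Re (a / (y - c) ^ n)"
    using iter_deriv_Re_inverse_power[OF R f] by blast
  from frechet_Re_inverse_power(1)[OF R x this]
  show "iter_deriv (exterior c R) vs f differentiable at x within exterior c R"
    by (auto simp: differentiable_def)
qed

lemma Re_mult_eq_inner: "Re (w * h) = cnj w \<bullet> h"
  by (simp add: inner_complex_def)

lemma dipole_eq: "dipole c R V x = Re (- (of_real (R\<^sup>2) * V) / (x - c) ^ 1)"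
proof -
  have "- (of_real (R\<^sup>2) * V) / (x - c) ^ 1 = of_real (- (R\<^sup>2)) * (V / (x - c))" by simp
  moreover have "dipole c R V x = Re (of_real (- (R\<^sup>2)) * (V / (x - c)))"
    by (simp only: dipole_def times_complex.sel Re_complex_of_real Im_complex_of_real mult_zero_left diff_zero)
  ultimately show ?thesis by (simp only:)
qed

lemma dipole_derivative:
  assumes R: "0 < R" and x: "x \<in> exterior c R"
  shows "(dipole c R V has_derivative (\<lambda>h. dipole_velocity c R V x \<bullet> h)) (at x within exterior c R)"
    and "frechet_derivative (dipole c R V) (at x within exterior c R) = (\<lambda>h. dipole_velocity c R V x \<bullet> h)"
    and "grad (exterior c R) (dipole c R V) x = dipole_velocity c R V x"
    and "laplacian (exterior c R) (dipole c R V) x = 0"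
proof -
  have eq: "(\<lambda>h. Re (- (of_nat 1 * (- (of_real (R\<^sup>2) * V)) * h) / (x - c) ^ Suc 1)) = (\<lambda>h. dipole_velocity c R V x \<bullet> h)"
    for x
  proof
    fix h
    have "Re (- (of_nat 1 * (- (of_real (R\<^sup>2) * V)) * h) / (x - c) ^ Suc 1) = Re (of_real (R\<^sup>2) * V / (x - c) ^ 2 * h)"
      by (simp add: power2_eq_square)
    also have "\<dots> = dipole_velocity c R V x \<bullet> h"
      unfolding dipole_velocity_def Re_mult_eq_inner ..
    finally show "Re (- (of_nat 1 * (- (of_real (R\<^sup>2) * V)) * h) / (x - c) ^ Suc 1) = dipole_velocity c R V x \<bullet> h" .
  qed
  show "(dipole c R V has_derivative (\<lambda>h. dipole_velocity c R V x \<bullet> h)) (at x within exterior c R)"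
    and D: "frechet_derivative (dipole c R V) (at x within exterior c R) = (\<lambda>h. dipole_velocity c R V x \<bullet> h)"
    using frechet_Re_inverse_power[OF R x dipole_eq[where c=c and R=R and V=V]] unfolding eq by blast+
  show "grad (exterior c R) (dipole c R V) x = dipole_velocity c R V x"
    by (simp add: grad_def D inner_complex_def complex_eq_iff)
  have "iter_deriv (exterior c R) [v, v] (dipole c R V) x = Re (- (of_nat 2 * (of_real (R\<^sup>2) * V * v) * v) / (x - c) ^ Suc 2)" for v
  proof -
    have "frechet_derivative (dipole c R V) (at y within exterior c R) v = Re ((of_real (R\<^sup>2) * V * v) / (y - c) ^ 2)"
      if "y \<in> exterior c R" for y
      using frechet_Re_inverse_power(2)[OF R that dipole_eq[where c=c and R=R and V=V]] by (simp add: eval_nat_numeral)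
    from frechet_Re_inverse_power(2)[OF R x this] show ?thesis by simp
  qed
  note iter = this
  show "laplacian (exterior c R) (dipole c R V) x = 0"
    unfolding laplacian_def iter by (simp add: mult.assoc)
qed

text \<open>
  On the circle of radius \<open>R\<close> one has \<open>R\<^sup>2 / z = cnj z\<close>; hence the normal component of the
  dipole flow is that of the constant velocity \<open>V\<close>.  The rotational part of the rigid velocity has no normal
  component there.
\<close>

lemma dipole_neumann_solution:
  assumes R: "0 < R" and q: "q \<in> config_space R"
  shows "neumann_solution R q gd (dipole (snd (fst q)) R (snd gd))"
proof -
  let ?c = "snd (fst q)" and ?V = "snd gd"
  let ?E = "exterior ?c R"
  have "grad ?E (dipole ?c R ?V) x \<bullet> unit_normal ?c x = rigid_velocity q gd x \<bullet> unit_normal ?c x"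
    if "x \<in> sphere ?c R" for x
  proof -
    define z where "z = x - ?c"
    have z: "norm z = R" using that by (simp add: z_def dist_norm norm_minus_commute)
    then have z0: "z \<noteq> 0" using R by auto
    have zz: "z * cnj z = of_real (R\<^sup>2)" using complex_norm_square[of z] z by simp
    have xE: "x \<in> ?E" using that by (simp add: exterior_def dist_norm norm_minus_commute)
    have n: "unit_normal ?c x = - (1 / R) *\<^sub>R z"
      using z by (simp add: unit_normal_def sgn_div_norm z_def norm_minus_commute divide_inverse_commute algebra_simps)
    have "dipole_velocity ?c R ?V x \<bullet> z = Re (of_real (R\<^sup>2) * ?V / z ^ 2 * z)"
      unfolding dipole_velocity_def z_def[symmetric] Re_mult_eq_inner ..
    also have "of_real (R\<^sup>2) * ?V / z ^ 2 * z = ?V * cnj z"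
      using z0 zz by (simp add: power2_eq_square field_simps)
    also have "Re \<dots> = rigid_velocity q gd x \<bullet> z"
      unfolding rigid_velocity_def z_def[symmetric] by (simp add: inner_complex_def algebra_simps)
    finally show ?thesis by (simp add: dipole_derivative(3)[OF R xE] n)
  qed
  moreover have "(dipole ?c R ?V \<longlongrightarrow> 0) (inf at_infinity (principal ?E))"
  proof (rule tendsto_mono[OF inf_le1])
    have "((\<lambda>x. ?V / (x - ?c)) \<longlongrightarrow> 0) at_infinity"
      by (intro tendsto_divide_0[OF tendsto_const] filterlim_at_infinity_conv_norm_at_top[THEN iffD2])
         (auto intro!: filterlim_at_infinity_imp_norm_at_top tendsto_add_filterlim_at_infinity'[of "\<lambda>x. x" _ "\<lambda>_. - ?c", simplified] filterlim_ident)
    then have "((\<lambda>x. - (R\<^sup>2) * Re (?V / (x - ?c))) \<longlongrightarrow> - (R\<^sup>2) * Re 0) at_infinity"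
      by (intro tendsto_intros)
    then show "(dipole ?c R ?V \<longlongrightarrow> 0) at_infinity" by (simp add: dipole_def[abs_def])
  qed
  ultimately show ?thesis
    unfolding neumann_solution_def Let_def config_space_geometry(4)[OF q R] frontier_exterior[OF R]
    by (auto simp: dipole_derivative[OF R] intro: smooth_on_Re_inverse_power[OF R dipole_eq])
qed

lemma neumann_solution_unique:
  assumes R: "0 < R" and q: "q \<in> config_space R" and 1: "neumann_solution R q gd \<Phi>"
    and x: "x \<in> exterior (snd (fst q)) R"
  shows "\<Phi> x = dipole (snd (fst q)) R (snd gd) x"
proof -
  let ?c = "snd (fst q)"
  let ?E = "exterior ?c R"
  have le: "\<Phi>1 x \<le> \<Phi>2 x" if 1: "neumann_solution R q gd \<Phi>1" and 2: "neumann_solution R q gd \<Phi>2" for \<Phi>1 \<Phi>2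
  proof (rule neumann_comparison[OF R _ _ _ _ _ x])
    note N = neumann_solution_def Let_def config_space_geometry(4)[OF q R] frontier_exterior[OF R]
    show "smooth_on ?E \<Phi>1" "smooth_on ?E \<Phi>2" using 1 2 unfolding N by auto
    show "laplacian ?E \<Phi>1 y = laplacian ?E \<Phi>2 y" if "y \<in> ?E" for y
      using 1 2 that unfolding N by auto
    show "((\<lambda>x. \<Phi>1 x - \<Phi>2 x) \<longlongrightarrow> 0) (inf at_infinity (principal ?E))"
      using 1 2 unfolding N by (auto intro: tendsto_eq_intros)
    show "grad ?E \<Phi>1 y \<bullet> (y - ?c) = grad ?E \<Phi>2 y \<bullet> (y - ?c)" if y: "y \<in> sphere ?c R" for y
    proof -
      have n: "y - ?c = (- R) *\<^sub>R unit_normal ?c y"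
        using y R by (simp add: unit_normal_def sgn_div_norm dist_norm)
      have "grad ?E \<Phi>1 y \<bullet> unit_normal ?c y = grad ?E \<Phi>2 y \<bullet> unit_normal ?c y"
        using 1 2 y unfolding N by metis
      then show ?thesis unfolding n by simp
    qed
  qed
  show ?thesis using le[OF 1 dipole_neumann_solution[OF R q]] le[OF dipole_neumann_solution[OF R q] 1] by simp
qed

text \<open>
  Derivatives within the fluid domain depend only on values there, so uniqueness of the solution
  identifies the derivatives as well.
\<close>

lemma neumann_solution_derivative:
  assumes R: "0 < R" and q: "q \<in> config_space R" and 1: "neumann_solution R q gd \<Phi>"
    and x: "x \<in> exterior (snd (fst q)) R"
  shows "frechet_derivative \<Phi> (at x within exterior (snd (fst q)) R) v = dipole_velocity (snd (fst q)) R (snd gd) x \<bullet> v"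
    and "grad (exterior (snd (fst q)) R) \<Phi> x = dipole_velocity (snd (fst q)) R (snd gd) x"
proof -
  let ?E = "exterior (snd (fst q)) R"
  have "frechet_derivative \<Phi> (at x within ?E) = frechet_derivative (dipole (snd (fst q)) R (snd gd)) (at x within ?E)"
    by (rule frechet_derivative_cong_within[OF x]) (rule neumann_solution_unique[OF R q 1])
  then show D: "frechet_derivative \<Phi> (at x within ?E) v = dipole_velocity (snd (fst q)) R (snd gd) x \<bullet> v" for v
    using dipole_derivative(2)[OF R x] by simp
  show "grad ?E \<Phi> x = dipole_velocity (snd (fst q)) R (snd gd) x"
    by (simp add: grad_def D inner_complex_def complex_eq_iff)
qed

lemma grad_neumann_potential:
  assumes R: "0 < R" and q: "q \<in> config_space R" and x: "x \<in> exterior (snd (fst q)) R"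
  shows "grad (fluid R q) (neumann_potential R q gd) x = dipole_velocity (snd (fst q)) R (snd gd) x"
proof -
  have "neumann_solution R q gd (neumann_potential R q gd)"
    unfolding neumann_potential_def by (rule someI[of "neumann_solution R q gd", OF dipole_neumann_solution[OF R q]])
  from neumann_solution_derivative(2)[OF R q this x] show ?thesis
    by (simp add: config_space_geometry(4)[OF q R])
qed

section \<open>The curvature as a vector field\<close>

text \<open>
  The circular flow that turns out to be the curvature in Eulerian form.  It is \<open>- \<i>\<close> times the gradient
  of \<open>J / |z|\<^sup>4\<close>.
\<close>

definition swirl :: "complex \<Rightarrow> real \<Rightarrow> complex \<Rightarrow> complex" where
  "swirl c J y = complex_of_real (4 * J / norm (y - c) ^ 6) * (\<i> * (y - c))"

lemma smooth_curve_point_differentiable: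
  assumes f: "smooth_on (UNIV \<times> S) (\<lambda>(t, x). f t x)" and x: "x \<in> S"
  shows "(\<lambda>t. f t x) differentiable (at (t::real))"
proof -
  have "(\<lambda>(t, x). f t x) differentiable at (t, x) within UNIV \<times> S"
    using smooth_on_differentiable[OF f] x unfolding differentiable_on_def by blast
  then have "(\<lambda>(t, x). f t x) differentiable at (t, x) within (\<lambda>t. (t, x)) ` UNIV"
    by (rule differentiable_within_subset) (use x in auto)
  moreover have "(\<lambda>t. (t, x)) differentiable at t"
    by (rule differentiableI[OF has_derivative_Pair[OF has_derivative_ident has_derivative_const]])
  ultimately have "((\<lambda>(t, x). f t x) \<circ> (\<lambda>t. (t, x))) differentiable at t"
    by (rule differentiable_chain_within[rotated])
  then show ?thesis by (simp add: o_def)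
qed

lemma dipole_velocity_curve_derivative:
  assumes W: "(W has_vector_derivative W') (at t)"
    and p: "(p has_vector_derivative u) (at t)"
    and x0: "(x0 has_vector_derivative V) (at t)"
    and nz: "p t \<noteq> x0 t"
  shows "((\<lambda>s. dipole_velocity (x0 s) R (W s) (p s)) has_vector_derivative
      cnj (of_real (R\<^sup>2) * (W' / (p t - x0 t) ^ 2 - 2 * W t * (u - V) / (p t - x0 t) ^ 3))) (at t)"
proof -
  define z where "z s = p s - x0 s" for s
  note W = W[unfolded has_vector_derivative_def]
  have z: "(z has_derivative (\<lambda>h. h *\<^sub>R (u - V))) (at t)"
    using has_vector_derivative_diff[OF p x0] unfolding has_vector_derivative_def z_def[abs_def] .
  have nz: "z t \<noteq> 0" using nz by (simp add: z_def)
  have alg: "- (of_real (R\<^sup>2) * W t) * (inverse (Z * Z) * (Z * (h *\<^sub>R D) + (h *\<^sub>R D) * Z) * inverse (Z * Z))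
      + of_real (R\<^sup>2) * (h *\<^sub>R W') / (Z * Z) = h *\<^sub>R (of_real (R\<^sup>2) * (W' / Z ^ 2 - 2 * W t * D / Z ^ 3))"
    if "Z \<noteq> 0" for Z D :: complex and h
    using that by (simp add: scaleR_conv_of_real field_simps eval_nat_numeral)
  have "((\<lambda>s. of_real (R\<^sup>2) * W s / (z s * z s)) has_derivative
      (\<lambda>h. h *\<^sub>R (of_real (R\<^sup>2) * (W' / z t ^ 2 - 2 * W t * (u - V) / z t ^ 3)))) (at t)"
    unfolding alg[OF nz, symmetric]
    by (intro has_derivative_divide has_derivative_mult has_derivative_mult_right W z) (use nz in simp)
  from bounded_linear.has_derivative[OF bounded_linear_cnj this]
  have "((\<lambda>s. cnj (of_real (R\<^sup>2) * W s / (z s * z s))) has_derivative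
      (\<lambda>h. h *\<^sub>R cnj (of_real (R\<^sup>2) * (W' / z t ^ 2 - 2 * W t * (u - V) / z t ^ 3)))) (at t)"
    by (simp only: complex_cnj_scaleR)
  moreover have "dipole_velocity (x0 s) R (W s) (p s) = cnj (of_real (R\<^sup>2) * W s / (z s * z s))" for s
    by (simp only: dipole_velocity_def power2_eq_square z_def)
  ultimately show ?thesis unfolding has_vector_derivative_def by (simp only: z_def)
qed

lemma horizontal_part_snd:
  assumes R: "0 < R" and q: "q \<in> config_space R" and x: "x \<in> exterior 0 R"
  shows "snd (horizontal_part R q U) x = dipole_velocity (snd (fst q)) R (snd (fst U)) (snd q x)"
proof -
  have "snd q x \<in> exterior (snd (fst q)) R" using config_space_geometry(3)[OF q R] x by blast
  from grad_neumann_potential[OF R q this] x show ?thesis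
    by (simp add: horizontal_part_def fluid0_eq[OF R])
qed

text \<open>
  One half of the bracket of two horizontal fields.  The first summand is the dipole flow of the
  rate of change of the translational velocity, hence again horizontal; the second one comes from the motion of the fluid
  particle relative to the body.
\<close>

lemma horizontal_field_derivative:
  fixes c :: "real \<Rightarrow> config" and Y :: "config \<Rightarrow> config_velocity" and t R :: real and x :: complex
  assumes R: "0 < R" and c: "smooth_curve R c" and Y: "smooth_vector_field R Y" and x: "x \<in> exterior 0 R"
  defines "A \<equiv> velocity_derivative (\<lambda>t. horizontal_part R (c t) (Y (c t))) t"
    and "u \<equiv> snd (curve_velocity c t) x" and "V \<equiv> snd (fst (curve_velocity c t))"
    and "z \<equiv> snd (c t) x - snd (fst (c t))"
  shows "snd A x = cnj (of_real (R\<^sup>2) * (snd (fst A) / z ^ 2 - 2 * snd (fst (Y (c t))) * (u - V) / z ^ 3))"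
proof -
  let ?W = "\<lambda>s. snd (fst (Y (c s)))"
  have cs: "c s \<in> config_space R" for s using c by (simp add: smooth_curve_def)
  have snd_diff: "(\<lambda>s. snd (f s)) differentiable at t" if "smooth_on UNIV f" for f :: "real \<Rightarrow> 'a::real_normed_vector \<times> complex"
  proof -
    have "(f has_derivative frechet_derivative f (at t)) (at t)"
      using smooth_on_has_derivative[OF that, of t] by simp
    from has_derivative_snd[OF this] show ?thesis by (rule differentiableI)
  qed
  have "(?W has_vector_derivative vector_derivative ?W (at t)) (at t)"
    using snd_diff[of "\<lambda>s. fst (Y (c s))"] Y c
    unfolding smooth_vector_field_def vector_derivative_works[symmetric] by blast
  moreover have "((\<lambda>s. snd (c s) x) has_vector_derivative u) (at t)"
    using smooth_curve_point_differentiable[of "exterior 0 R" "\<lambda>s. snd (c s)" x t] c x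
    unfolding u_def curve_velocity_def snd_conv vector_derivative_works[symmetric] smooth_curve_def fluid0_eq[OF R] by blast
  moreover have "((\<lambda>s. snd (fst (c s))) has_vector_derivative V) (at t)"
    using snd_diff[of "\<lambda>s. fst (c s)"] c
    unfolding V_def curve_velocity_def fst_conv snd_conv vector_derivative_works[symmetric] smooth_curve_def by blast
  moreover have "snd (c t) x \<noteq> snd (fst (c t))"
  proof -
    have "snd (c t) x \<in> exterior (snd (fst (c t))) R"
      using config_space_geometry(3)[OF cs R] x by blast
    then show ?thesis using R by (auto simp: exterior_def)
  qed
  ultimately have "((\<lambda>s. dipole_velocity (snd (fst (c s))) R (?W s) (snd (c s) x)) has_vector_derivative
      cnj (of_real (R\<^sup>2) * (vector_derivative ?W (at t) / z ^ 2 - 2 * ?W t * (u - V) / z ^ 3))) (at t)"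
    unfolding z_def by (rule dipole_velocity_curve_derivative)
  then have "vector_derivative (\<lambda>s. snd (horizontal_part R (c s) (Y (c s))) x) (at t) =
      cnj (of_real (R\<^sup>2) * (vector_derivative ?W (at t) / z ^ 2 - 2 * ?W t * (u - V) / z ^ 3))"
    unfolding horizontal_part_snd[OF R cs x] by (rule vector_derivative_at)
  moreover have "snd (fst A) = vector_derivative ?W (at t)"
    by (simp add: A_def velocity_derivative_def horizontal_part_def)
  ultimately show ?thesis by (simp add: A_def velocity_derivative_def)
qed

text \<open>
  The algebra behind the curvature: once the horizontal part of the bracket has been subtracted, the
  terms in \<open>V'\<close> and \<open>W'\<close> cancel, and so do the two products \<open>V W\<close>.  What is left is the
  antisymmetric combination \<open>V cnj W - W cnj V\<close>.
\<close>

lemma dipole_commutator: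
  fixes z V W V' W' :: complex and R :: real
  assumes z: "z \<noteq> 0"
  defines "u \<equiv> \<lambda>V. cnj (of_real (R\<^sup>2) * V / z ^ 2)"
  shows "cnj (of_real (R\<^sup>2) * (W' / z ^ 2 - 2 * W * (u V - V) / z ^ 3))
      - cnj (of_real (R\<^sup>2) * (V' / z ^ 2 - 2 * V * (u W - W) / z ^ 3))
      - cnj (of_real (R\<^sup>2) * (W' - V') / z ^ 2)
    = - (of_real (4 * (R ^ 4 * Im (V * cnj W)) / norm z ^ 6) * (\<i> * z))"
proof -
  have "cnj (of_real (R\<^sup>2) * (W' / z ^ 2 - 2 * W * (u V - V) / z ^ 3))
      - cnj (of_real (R\<^sup>2) * (V' / z ^ 2 - 2 * V * (u W - W) / z ^ 3))
      - cnj (of_real (R\<^sup>2) * (W' - V') / z ^ 2)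
    = cnj (of_real (R\<^sup>2) * 2 * (V * u W - W * u V) / z ^ 3)"
    by (simp add: diff_divide_distrib algebra_simps)
  also have "V * u W - W * u V = of_real (R\<^sup>2) * (2 * \<i> * of_real (Im (V * cnj W))) / cnj z ^ 2"
  proof -
    have "2 * \<i> * of_real (Im (V * cnj W)) = V * cnj W - W * cnj V"
      by (simp add: complex_eq_iff algebra_simps)
    then show ?thesis unfolding u_def by (simp only:) (simp add: algebra_simps diff_divide_distrib)
  qed
  also have "cnj (of_real (R\<^sup>2) * 2 * (of_real (R\<^sup>2) * (2 * \<i> * of_real (Im (V * cnj W))) / cnj z ^ 2) / z ^ 3)
      = - (of_real (4 * (R ^ 4 * Im (V * cnj W))) * \<i> / (z ^ 2 * cnj z ^ 3))"
    by (simp add: eval_nat_numeral divide_simps)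
  also have "\<dots> = - (of_real (4 * (R ^ 4 * Im (V * cnj W)) / norm z ^ 6) * (\<i> * z))"
  proof -
    have "of_real (norm z ^ 6) = (z * cnj z) ^ 3"
      unfolding complex_norm_square[symmetric] by (simp flip: of_real_power power_mult)
    then have "of_real (norm z ^ 6) = z * (z ^ 2 * cnj z ^ 3)"
      by (simp add: eval_nat_numeral)
    then show ?thesis using z by (simp only: of_real_divide) (simp add: divide_simps)
  qed
  finally show ?thesis .
qed

text \<open>
  The result involves only the translational velocities at the given point, so it does not depend on the
  extensions of the tangent vectors or on the curves used for the bracket.
\<close>

lemma neumann_curvature_swirl:
  assumes R: "0 < R" and q: "q \<in> config_space R" and curv: "is_neumann_curvature R q U V w"
    and x: "x \<in> exterior 0 R"
  shows "frechet_derivative (snd q) (at x within exterior 0 R) (w x) =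
    swirl (snd (fst q)) (R ^ 4 * Im (snd (fst U) * cnj (snd (fst V)))) (snd q x)"
proof -
  from curv obtain X Y Z where X: "smooth_vector_field R X" "X q = U" and Y: "smooth_vector_field R Y" "Y q = V"
    and br: "is_lie_bracket R (\<lambda>p. horizontal_part R p (X p)) (\<lambda>p. horizontal_part R p (Y p)) q Z"
    and w: "w = (\<lambda>x. - neumann_connection R q Z x)"
    unfolding is_neumann_curvature_def by blast
  from br obtain c e where c: "smooth_curve R c" "c 0 = q" "curve_velocity c 0 = horizontal_part R q U"
    and e: "smooth_curve R e" "e 0 = q" "curve_velocity e 0 = horizontal_part R q V"
    and Z: "Z = (fst (velocity_derivative (\<lambda>t. horizontal_part R (c t) (Y (c t))) 0)
                 - fst (velocity_derivative (\<lambda>t. horizontal_part R (e t) (X (e t))) 0),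
               \<lambda>x. snd (velocity_derivative (\<lambda>t. horizontal_part R (c t) (Y (c t))) 0) x
                 - snd (velocity_derivative (\<lambda>t. horizontal_part R (e t) (X (e t))) 0) x)"
    unfolding is_lie_bracket_def Let_def X Y by blast
  let ?A = "velocity_derivative (\<lambda>t. horizontal_part R (c t) (Y (c t))) 0"
  let ?B = "velocity_derivative (\<lambda>t. horizontal_part R (e t) (X (e t))) 0"
  let ?c = "snd (fst q)" and ?V = "snd (fst U)" and ?W = "snd (fst V)"
  define z where "z = snd q x - ?c"
  have yE: "snd q x \<in> exterior ?c R" using config_space_geometry(3)[OF q R] x by blast
  then have z0: "z \<noteq> 0" using R by (auto simp: exterior_def z_def)
  have dip: "dipole_velocity ?c R v (snd q x) = cnj (of_real (R\<^sup>2) * v / z ^ 2)" for v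
    by (simp add: dipole_velocity_def z_def)
  have fsth: "fst (horizontal_part R q U) = fst U" for U by (simp add: horizontal_part_def)
  have A: "snd ?A x = cnj (of_real (R\<^sup>2) * (snd (fst ?A) / z ^ 2 - 2 * ?W * (cnj (of_real (R\<^sup>2) * ?V / z ^ 2) - ?V) / z ^ 3))"
    using horizontal_field_derivative[OF R c(1) Y(1) x, of 0]
    unfolding c(2,3) Y(2) horizontal_part_snd[OF R q x] dip z_def[symmetric] fsth .
  have B: "snd ?B x = cnj (of_real (R\<^sup>2) * (snd (fst ?B) / z ^ 2 - 2 * ?V * (cnj (of_real (R\<^sup>2) * ?W / z ^ 2) - ?W) / z ^ 3))"
    using horizontal_field_derivative[OF R e(1) X(1) x, of 0]
    unfolding e(2,3) X(2) horizontal_part_snd[OF R q x] dip z_def[symmetric] fsth .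
  have "inv_into (exterior 0 R) (snd q) (snd q x) = x"
    using config_space_geometry(2)[OF q R] x by (rule inv_into_f_f)
  then have "vortical_part R q Z (snd q x) = snd ?A x - snd ?B x - dipole_velocity ?c R (snd (fst ?A) - snd (fst ?B)) (snd q x)"
    by (simp add: vortical_part_def eulerian_velocity_def grad_neumann_potential[OF R q yE] fluid0_eq[OF R] Z)
  also have "\<dots> = - swirl ?c (R ^ 4 * Im (?V * cnj ?W)) (snd q x)"
    unfolding A B dip swirl_def z_def[symmetric] by (rule dipole_commutator[OF z0])
  finally have vort: "vortical_part R q Z (snd q x) = - swirl ?c (R ^ 4 * Im (?V * cnj ?W)) (snd q x)" .
  let ?D = "frechet_derivative (snd q) (at x within exterior 0 R)"
  have lin: "linear ?D"
    using smooth_on_has_derivative[OF config_space_geometry(1)[OF q R] x] by (rule has_derivative_linear)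
  have "inj ?D"
    using q x by (auto simp: config_space_def smooth_embedding_def fluid0_eq[OF R])
  then have "surj ?D" using lin by (simp add: linear_injective_imp_surjective)
  then have "?D (inv ?D v) = v" for v by (simp add: surj_f_inv_f)
  then show ?thesis
    using x linear_neg[OF lin]
    by (simp add: w neumann_connection_def pullback_field_def fluid0_eq[OF R] vort)
qed

section \<open>Pairing with the curvature field\<close>

lemma area_form_eq: "area_form a b = Im (cnj a * b)"
  by (simp add: area_form_def)

lemma abs_area_form_le: "\<bar>area_form a b\<bar> \<le> norm a * norm b"
  unfolding area_form_eq using abs_Im_le_cmod[of "cnj a * b"] by (simp add: norm_mult)

lemma norm_swirl: "y \<noteq> c \<Longrightarrow> norm (swirl c J y) = 4 * \<bar>J\<bar> / norm (y - c) ^ 5"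
  unfolding swirl_def norm_mult norm_of_real by (simp add: abs_mult eval_nat_numeral)

lemma swirl_polar:
  assumes "0 < r"
  shows "swirl c J (polar c r t) = (4 * J / r ^ 6) *\<^sub>R (of_real r * (\<i> * cis t))"
  using assms by (simp add: swirl_def polar_def norm_mult scaleR_conv_of_real)

lemma smooth_on_continuous: "smooth_on S f \<Longrightarrow> continuous_on S f"
  by (intro differentiable_imp_continuous_on smooth_on_differentiable)

lemma smooth_on_continuous_deriv: "smooth_on S f \<Longrightarrow> continuous_on S (\<lambda>x. frechet_derivative f (at x within S) v)"
  by (intro differentiable_imp_continuous_on smooth_on_differentiable_deriv)

text \<open>
  The form \<open>\<gamma>\<close> differs from the pull-back of \<open>u\<close> by an exact form \<open>df\<close>.  After transport to the
  fluid domain, \<open>df\<close> evaluated on the circular flow is a function of the radius times the angular derivative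
  of \<open>f \<circ> \<phi>\<^sup>-\<^sup>1\<close>, and such a term integrates to zero over each circle.
\<close>

lemma swirl_pairing:
  fixes q :: config and R J :: real and u w :: "complex \<Rightarrow> complex" and f :: "complex \<Rightarrow> real" and \<gamma> :: form1
  defines "E0 \<equiv> exterior 0 R" and "\<phi> \<equiv> snd q" and "c \<equiv> snd (fst q)"
  defines "D \<equiv> \<lambda>x. frechet_derivative \<phi> (at x within E0)"
    and "p \<equiv> \<lambda>r t. u (polar c r t) \<bullet> (\<i> * cis t)"
  assumes R: "0 < R" and q: "q \<in> config_space R"
    and \<gamma>: "\<gamma> \<in> one_forms E0" and f: "smooth_on E0 f"
    and \<gamma>_eq: "\<And>x v. x \<in> E0 \<Longrightarrow> \<gamma> x v = u (\<phi> x) \<bullet> D x v + frechet_derivative f (at x within E0) v"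
    and w: "\<And>x. x \<in> E0 \<Longrightarrow> D x (w x) = swirl c J (\<phi> x)"
    and dom: "strip_dominated R (\<lambda>r t. 4 * J * p r t / r ^ 4)" "strip_dominated R (\<lambda>r t. 4 * (- J) * p r t / r ^ 4)"
  shows "(LINT x:E0|lborel. \<gamma> x (w x)) = strip_integral R (\<lambda>r t. 4 * J * p r t / r ^ 4)"
proof -
  let ?E = "exterior c R"
  note geo = config_space_geometry[OF q R, folded E0_def \<phi>_def c_def]
  define \<psi> where "\<psi> = inv_into E0 \<phi>"
  have \<psi>\<phi>: "\<psi> (\<phi> x) = x" if "x \<in> E0" for x
    unfolding \<psi>_def using inv_into_f_f[OF geo(2) that] .
  have \<phi>E: "\<phi> x \<in> ?E" if "x \<in> E0" for x using geo(3) that by blast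
  have \<psi>E: "\<psi> y \<in> E0" and \<phi>\<psi>: "\<phi> (\<psi> y) = y" if "y \<in> ?E" for y
    using inv_into_into[of y \<phi> E0] f_inv_into_f[of y \<phi> E0] that unfolding \<psi>_def geo(3) by blast+
  have cont\<psi>: "continuous_on ?E \<psi>" unfolding \<psi>_def by (rule geo(6))
  have D: "(\<phi> has_derivative D x) (at x within E0)" if "x \<in> E0" for x
    unfolding D_def by (rule smooth_on_has_derivative[OF geo(1) that])
  have linD: "linear (D x)" if "x \<in> E0" for x by (rule has_derivative_linear[OF D[OF that]])
  have area: "area_form (D x v) (D x v') = area_form v v'" if "x \<in> E0" for x v v'
    unfolding D_def by (rule geo(8)[OF that])
  have nz: "\<phi> x \<noteq> c" if "x \<in> E0" for x using \<phi>E[OF that] R by (auto simp: exterior_def)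
  \<comment> \<open>Preservation of area inverts the derivative explicitly, which shows that \<open>w\<close> is continuous and bounded.\<close>
  have w_eq: "w x = Complex (area_form (swirl c J (\<phi> x)) (D x \<i>)) (area_form (D x 1) (swirl c J (\<phi> x)))" if "x \<in> E0" for x
    unfolding w[OF that, symmetric] area[OF that] by (simp add: area_form_def)
  define H where "H x = \<gamma> x (w x)" for x
  have lin\<gamma>: "linear (\<gamma> x)" if "x \<in> E0" for x using \<gamma> that by (simp add: one_forms_def)
  have sm\<gamma>: "smooth_decaying 1 E0 (\<lambda>x. \<gamma> x v)" for v using \<gamma> by (simp add: one_forms_def)
  have H_eq: "H x = area_form (swirl c J (\<phi> x)) (D x \<i>) * \<gamma> x 1 + area_form (D x 1) (swirl c J (\<phi> x)) * \<gamma> x \<i>" if "x \<in> E0" for x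
    using linear_complex_components[OF lin\<gamma>[OF that], of "w x"] w_eq[OF that] by (simp add: H_def)
  have contD: "continuous_on E0 (\<lambda>x. D x v)" for v
    unfolding D_def by (rule smooth_on_continuous_deriv[OF geo(1)])
  have cont\<gamma>: "continuous_on E0 (\<lambda>x. \<gamma> x v)" for v
    using sm\<gamma>[of v] smooth_on_continuous unfolding smooth_decaying_def by blast
  have contH: "continuous_on E0 H"
  proof (rule continuous_on_eq)
    have "continuous_on E0 (\<lambda>x. swirl c J (\<phi> x))"
      unfolding swirl_def by (intro continuous_intros smooth_on_continuous[OF geo(1)]) (use nz in auto)
    then show "continuous_on E0 (\<lambda>x. area_form (swirl c J (\<phi> x)) (D x \<i>) * \<gamma> x 1 + area_form (D x 1) (swirl c J (\<phi> x)) * \<gamma> x \<i>)"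
      unfolding area_form_eq by (intro continuous_intros contD cont\<gamma>)
  qed (rule H_eq[symmetric])
  obtain K1 where K1: "\<And>x. x \<in> E0 \<Longrightarrow> \<bar>\<gamma> x 1\<bar> \<le> K1"
    using smooth_decaying_bounded[OF sm\<gamma>, of "[]" 1] by auto
  obtain K2 where K2: "\<And>x. x \<in> E0 \<Longrightarrow> \<bar>\<gamma> x \<i>\<bar> \<le> K2"
    using smooth_decaying_bounded[OF sm\<gamma>, of "[]" \<i>] by auto
  obtain B where B: "\<And>x v. x \<in> E0 \<Longrightarrow> norm (D x v) \<le> B * norm v"
    using geo(7) unfolding D_def by blast
  have boundH: "\<bar>H x\<bar> \<le> (4 * \<bar>J\<bar> * B * (K1 + K2) / R) / norm (\<phi> x - c) ^ 4" if x: "x \<in> E0" for x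
  proof -
    let ?n = "norm (\<phi> x - c)"
    have n: "R \<le> ?n" using \<phi>E[OF x] by (simp add: exterior_def)
    have sw: "norm (swirl c J (\<phi> x)) = 4 * \<bar>J\<bar> / ?n ^ 5" by (rule norm_swirl[OF nz[OF x]])
    have B0: "0 \<le> B" using B[OF x, of 1] by (metis mult_cancel_left1 norm_ge_zero norm_one order_trans mult.right_neutral)
    have a1: "\<bar>area_form (swirl c J (\<phi> x)) (D x \<i>)\<bar> \<le> 4 * \<bar>J\<bar> / ?n ^ 5 * B"
      using B[OF x, of \<i>] unfolding sw[symmetric]
      by (intro order_trans[OF abs_area_form_le] mult_left_mono) auto
    have a2: "\<bar>area_form (D x 1) (swirl c J (\<phi> x))\<bar> \<le> B * (4 * \<bar>J\<bar> / ?n ^ 5)"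
      using B[OF x, of 1] unfolding sw[symmetric]
      by (intro order_trans[OF abs_area_form_le] mult_right_mono) auto
    have K0: "0 \<le> K1" "0 \<le> K2" using K1[OF x] K2[OF x] by linarith+
    have "\<bar>H x\<bar> \<le> \<bar>area_form (swirl c J (\<phi> x)) (D x \<i>)\<bar> * \<bar>\<gamma> x 1\<bar> + \<bar>area_form (D x 1) (swirl c J (\<phi> x))\<bar> * \<bar>\<gamma> x \<i>\<bar>"
      unfolding H_eq[OF x] by (rule order_trans[OF abs_triangle_ineq]) (simp add: abs_mult)
    also have "\<dots> \<le> 4 * \<bar>J\<bar> / ?n ^ 5 * B * K1 + B * (4 * \<bar>J\<bar> / ?n ^ 5) * K2"
      using a1 a2 K1[OF x] K2[OF x] B0 K0 by (intro add_mono mult_mono) auto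
    also have "\<dots> = 4 * \<bar>J\<bar> * B * (K1 + K2) / (?n * ?n ^ 4)"
      by (simp add: algebra_simps add_divide_distrib eval_nat_numeral)
    also have "\<dots> \<le> 4 * \<bar>J\<bar> * B * (K1 + K2) / (R * ?n ^ 4)"
      using n R B0 K0 by (intro divide_left_mono mult_right_mono mult_pos_pos zero_less_power) auto
    finally show ?thesis by simp
  qed
  define G where "G y = H (\<psi> y)" for y
  have contG: "continuous_on ?E G"
    unfolding G_def by (rule continuous_on_compose2[OF contH cont\<psi>]) (use \<psi>E in auto)
  have boundG: "\<bar>G y\<bar> \<le> (4 * \<bar>J\<bar> * B * (K1 + K2) / R) / norm (y - c) ^ 4" if "y \<in> ?E" for y
    using boundH[OF \<psi>E[OF that]] by (simp add: G_def \<phi>\<psi>[OF that])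
  note polar_G = integral_exterior_polar[OF R contG boundG]
  have jac: "\<bar>area_form (D x 1) (D x \<i>)\<bar> = 1" if "x \<in> E0" for x
    unfolding area[OF that] by (simp add: area_form_def)
  have "(LINT x:E0|lborel. \<gamma> x (w x)) = (LINT x:E0|lborel. \<bar>area_form (D x 1) (D x \<i>)\<bar> * G (\<phi> x))"
  proof (rule set_lebesgue_integral_cong)
    show "E0 \<in> sets lborel" by (simp add: E0_def)
    show "\<forall>x. x \<in> E0 \<longrightarrow> \<gamma> x (w x) = \<bar>area_form (D x 1) (D x \<i>)\<bar> * G (\<phi> x)"
      by (simp add: jac G_def \<psi>\<phi> H_def)
  qed
  also have "\<dots> = (LINT y:\<phi> ` E0|lborel. G y)"
  proof (rule change_of_variables_complex(3)[OF _ D geo(2)])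
    show E0: "E0 \<in> sets borel" by (simp add: E0_def)
    have "continuous_on E0 (\<lambda>x. \<bar>area_form (D x 1) (D x \<i>)\<bar> * G (\<phi> x))"
      by (rule continuous_on_eq[OF contH]) (simp add: jac G_def \<psi>\<phi>)
    then show "set_borel_measurable borel E0 (\<lambda>x. \<bar>area_form (D x 1) (D x \<i>)\<bar> * G (\<phi> x))"
      unfolding set_borel_measurable_def by (rule borel_measurable_continuous_on_indicator[OF E0])
    show "set_borel_measurable borel (\<phi> ` E0) G"
      unfolding geo(3) set_borel_measurable_def
      by (rule borel_measurable_continuous_on_indicator[OF _ contG]) simp
    show "set_integrable lborel E0 (\<lambda>x. \<bar>area_form (D x 1) (D x \<i>)\<bar> * G (\<phi> x)) \<or> set_integrable lborel (\<phi> ` E0) G"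
      unfolding geo(3) using polar_G(2) by blast
  qed
  also have "\<dots> = strip_integral R (\<lambda>r t. r * G (polar c r t))"
    unfolding geo(3) by (rule polar_G(3))
  also have "\<dots> = strip_integral R (\<lambda>r t. 4 * J * p r t / r ^ 4 + (r * G (polar c r t) + 4 * (- J) * p r t / r ^ 4))"
    by (rule strip_integral_cong) simp
  also have "\<dots> = strip_integral R (\<lambda>r t. 4 * J * p r t / r ^ 4)
      + strip_integral R (\<lambda>r t. r * G (polar c r t) + 4 * (- J) * p r t / r ^ 4)"
    by (rule strip_integral_add[OF dom(1) strip_dominated_add[OF polar_G(1) dom(2)] R])
  also have "strip_integral R (\<lambda>r t. r * G (polar c r t) + 4 * (- J) * p r t / r ^ 4) = 0"
  proof (rule strip_integral_angular_derivative[OF strip_dominated_add[OF polar_G(1) dom(2)] R, 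
        where Q="\<lambda>r t. 4 * J / r ^ 5 * f (\<psi> (polar c r t))"])
    fix r t assume r: "R \<le> r" and t: "t \<in> {0..2*pi}"
    have r0: "0 < r" using r R by simp
    let ?y = "polar c r t" and ?I = "{0..2*pi}"
    let ?x = "\<psi> ?y" and ?v = "of_real r * (\<i> * cis t)"
    have polE: "polar c r s \<in> ?E" for s by (rule polar_exterior[OF R r])
    have x: "?x \<in> E0" and \<phi>x: "\<phi> ?x = ?y" using \<psi>E[OF polE] \<phi>\<psi>[OF polE] by blast+
    have "inj (D ?x)"
      using q x R unfolding config_space_def smooth_embedding_def fluid0_eq[OF R] E0_def D_def \<phi>_def by auto
    define T where "T = inv (D ?x)"
    have TD: "T \<circ> D ?x = id" unfolding T_def using \<open>inj (D ?x)\<close> by (rule inv_o_cancel)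
    have linT: "linear T" unfolding T_def using linD[OF x] \<open>inj (D ?x)\<close> by (rule inj_linear_imp_inv_linear)
    \<comment> \<open>Derivatives within the closed domains are needed here, as \<open>r = R\<close> is allowed.\<close>
    have "(\<psi> has_derivative T) (at ?y within ?E)"
    proof -
      have "continuous (at (\<phi> ?x) within \<phi> ` E0) \<psi>"
        using cont\<psi> polE unfolding \<phi>x geo(3) continuous_on_eq_continuous_within by blast
      from has_derivative_inverse_within[OF D[OF x] this x linT TD \<psi>\<phi>]
      show ?thesis unfolding \<phi>x geo(3) .
    qed
    then have "(\<psi> has_derivative T) (at ?y within polar c r ` ?I)"
      by (rule has_derivative_subset) (use polE in blast)
    from diff_chain_within[OF polar_derivative_angle this]
    have d\<psi>: "((\<lambda>t. \<psi> (polar c r t)) has_derivative (\<lambda>h. T (h *\<^sub>R ?v))) (at t within ?I)"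
      by (simp add: o_def)
    have "(f has_derivative frechet_derivative f (at ?x within E0)) (at ?x within (\<lambda>t. \<psi> (polar c r t)) ` ?I)"
      by (rule has_derivative_subset[OF smooth_on_has_derivative[OF f x]]) (use \<psi>E polE in blast)
    from diff_chain_within[OF d\<psi> this]
    have df: "((\<lambda>t. f (\<psi> (polar c r t))) has_derivative (\<lambda>h. frechet_derivative f (at ?x within E0) (T (h *\<^sub>R ?v)))) (at t within ?I)"
      by (simp add: o_def)
    have linf: "linear (frechet_derivative f (at ?x within E0))"
      by (rule has_derivative_linear[OF smooth_on_has_derivative[OF f x]])
    let ?L = "frechet_derivative f (at ?x within E0) (T ?v)"
    have "((\<lambda>t. f (\<psi> (polar c r t))) has_vector_derivative ?L) (at t within ?I)"
      using df unfolding has_vector_derivative_def linear_scale[OF linT] linear_scale[OF linf] .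
    then have "((\<lambda>t. 4 * J / r ^ 5 * f (\<psi> (polar c r t))) has_vector_derivative 4 * J / r ^ 5 * ?L) (at t within ?I)"
      by (rule has_vector_derivative_mult_right)
    moreover have "r * G ?y + 4 * (- J) * p r t / r ^ 4 = 4 * J / r ^ 5 * ?L"
    proof -
      have sw: "swirl c J ?y = (4 * J / r ^ 6) *\<^sub>R ?v" by (rule swirl_polar[OF r0])
      have "w ?x = T (D ?x (w ?x))" using fun_cong[OF TD, of "w ?x"] by simp
      then have wx: "w ?x = (4 * J / r ^ 6) *\<^sub>R T ?v"
        unfolding w[OF x] \<phi>x sw linear_scale[OF linT] .
      have "u ?y \<bullet> ?v = r * p r t"
        unfolding p_def by (simp flip: scaleR_conv_of_real)
      then have "G ?y = (4 * J / r ^ 6) * (r * p r t) + (4 * J / r ^ 6) * ?L"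
        unfolding G_def H_def \<gamma>_eq[OF x] w[OF x] \<phi>x sw
        unfolding wx linear_scale[OF linf] by simp
      then have "r * G ?y + 4 * (- J) * p r t / r ^ 4 = r * ((4 * J / r ^ 6) * (r * p r t) + (4 * J / r ^ 6) * ?L) + 4 * (- J) * p r t / r ^ 4"
        by simp
      also have "r * ((4 * J / r ^ 6) * (r * P) + (4 * J / r ^ 6) * L) + 4 * (- J) * P / r ^ 4 = 4 * J / r ^ 5 * L" for P L
        using r0 by (simp add: field_simps eval_nat_numeral)
      finally show ?thesis .
    qed
    ultimately show "((\<lambda>t. 4 * J / r ^ 5 * f (\<psi> (polar c r t))) has_vector_derivative r * G (polar c r t) + 4 * (- J) * p r t / r ^ 4) (at t within ?I)"
      by simp
  next
    show "4 * J / r ^ 5 * f (\<psi> (polar c r (2 * pi))) = 4 * J / r ^ 5 * f (\<psi> (polar c r 0))" for r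
      by (simp add: polar_def)
  qed
  finally show ?thesis by simp
qed

text \<open>
  This is the function \<open>\<star>(d\<Phi>\<^sub>1 \<and> d\<Phi>\<^sub>2)\<close>.
\<close>

lemma area_form_dipole_velocity:
  "area_form (dipole_velocity c R V x) (dipole_velocity c R W x) = R ^ 4 * Im (V * cnj W) / norm (x - c) ^ 4"
proof -
  define z where "z = x - c"
  have n: "norm z ^ 4 = (norm (z ^ 2))\<^sup>2" by (simp add: norm_power flip: power_mult)
  have "area_form (dipole_velocity c R V x) (dipole_velocity c R W x) = Im (of_real (R\<^sup>2) * V / z ^ 2 * cnj (of_real (R\<^sup>2) * W / z ^ 2))"
    unfolding area_form_eq dipole_velocity_def z_def complex_cnj_cnj ..
  also have "of_real (R\<^sup>2) * V / z ^ 2 * cnj (of_real (R\<^sup>2) * W / z ^ 2) = of_real (R\<^sup>2 * R\<^sup>2) * (V * cnj W) / (z ^ 2 * cnj (z ^ 2))"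
    unfolding complex_cnj_divide complex_cnj_mult complex_cnj_complex_of_real of_real_mult times_divide_times_eq
    by (simp only: mult_ac)
  also have "z ^ 2 * cnj (z ^ 2) = of_real (norm z ^ 4)"
    unfolding n by (rule complex_norm_square[symmetric])
  also have "of_real (R\<^sup>2 * R\<^sup>2) * (V * cnj W) / of_real (norm z ^ 4) = (R\<^sup>2 * R\<^sup>2 / norm z ^ 4) *\<^sub>R (V * cnj W)"
    by (simp only: scaleR_conv_of_real of_real_divide times_divide_eq_left)
  also have "Im \<dots> = R ^ 4 * Im (V * cnj W) / norm z ^ 4"
    by (simp only: scaleR_complex.sel) (simp add: eval_nat_numeral)
  finally show ?thesis by (simp only: z_def)
qed

text \<open>
  The sign records that the boundary of an exterior domain is traversed clockwise.
\<close>

lemma boundary_integral_polar: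
  assumes R: "0 < R" and g: "fst (fst q) = cis b" and b: "0 \<le> b" "b \<le> 2 * pi"
    and u: "continuous_on (sphere (snd (fst q)) R) u"
    and \<alpha>: "\<And>x v. x \<in> sphere (snd (fst q)) R \<Longrightarrow> \<alpha> x v = k * (u x \<bullet> v)"
  shows "boundary_integral R q \<alpha> = - k * R * integral {0..2*pi} (\<lambda>t. u (polar (snd (fst q)) R t) \<bullet> (\<i> * cis t))"
proof -
  let ?c = "snd (fst q)"
  define p where "p t = u (polar ?c R t) \<bullet> (\<i> * cis t)" for t
  have path: "boundary_path R q = (\<lambda>t. polar ?c R (b - t))"
    by (rule ext) (simp add: boundary_path_def se2_act_def g polar_def cis_mult mult.left_commute add.commute[of ?c])
  have vel: "vector_derivative (boundary_path R q) (at t) = - R *\<^sub>R (\<i> * cis (b - t))" for t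
    unfolding path polar_def
    by (rule vector_derivative_at)
       (auto simp: has_vector_derivative_def scaleR_conv_of_real fun_eq_iff intro!: derivative_eq_intros)
  have sph: "polar ?c R t \<in> sphere ?c R" for t
    using R by (simp add: polar_def dist_norm norm_mult)
  have "boundary_integral R q \<alpha> = integral {0..2*pi} (\<lambda>t. - k * R * p (b - t))"
    unfolding boundary_integral_def vel unfolding path p_def using sph by (simp add: \<alpha> path mult_ac)
  also have "\<dots> = - k * R * integral {0..2*pi} (\<lambda>t. p (b - t))"
    by (rule integral_mult_right)
  also have "integral {0..2*pi} (\<lambda>t. p (b - t)) = integral {0..2*pi} p"
  proof (rule integral_periodic_reflect_shift[OF _ _ b])
    show "continuous_on UNIV p"
      unfolding p_def
      by (intro continuous_intros continuous_on_compose2[OF u]) (use sph in auto)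
    show "p (t + 2 * pi) = p t" for t
      by (simp add: p_def polar_def cis.ctr)
  qed
  finally show ?thesis unfolding p_def .
qed

section \<open>The curvature formula\<close>

theorem proposition3p2:
  fixes R :: real and g :: se2 and \<phi> \<phi>d1 \<phi>d2 uv w :: "complex \<Rightarrow> complex"
    and gd1 gd2 :: se2_velocity and \<Phi>1 \<Phi>2 :: "complex \<Rightarrow> real"
    and \<mu> :: "form1 set" and \<alpha> :: form1
  defines "F \<equiv> fluid R (g, \<phi>)"
  assumes "0 < R"
    and "(g, \<phi>) \<in> config_space R"
    and "(gd1, \<phi>d1) \<in> config_tangent R (g, \<phi>)"
    and "(gd2, \<phi>d2) \<in> config_tangent R (g, \<phi>)"
    and "neumann_solution R (g, \<phi>) gd1 \<Phi>1"
    and "neumann_solution R (g, \<phi>) gd2 \<Phi>2"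
    and "\<mu> \<in> Xvol_dual R"
    and "\<mu> = form_class R (pullback_form R \<phi> \<alpha>)"
    and "uv \<in> divfree_tangent 1 F (snd g)"
    and "\<forall>x\<in>F. \<alpha> x = flat uv x"
    and "is_neumann_curvature R (g, \<phi>) (gd1, \<phi>d1) (gd2, \<phi>d2) w"
  shows "dual_pairing R \<mu> w =
      L2_form2 F (d1 F \<alpha>) (wedge11 (d0 F \<Phi>1) (d0 F \<Phi>2))
      - boundary_integral R (g, \<phi>)
          (wedge10 \<alpha> (hodge_star2 (wedge11 (d0 F \<Phi>1) (d0 F \<Phi>2))))"
proof -
  note R = \<open>0 < R\<close> and q = \<open>(g, \<phi>) \<in> config_space R\<close>
  let ?q = "(g, \<phi>)" and ?S = "exterior 0 R" and ?E = "exterior (snd g) R"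
  note geo = config_space_geometry[OF q R, unfolded fst_conv snd_conv]
  have F: "F = ?E" unfolding F_def by (rule geo(4))
  define J where "J = R ^ 4 * Im (snd gd1 * cnj (snd gd2))"
  define D where "D y = frechet_derivative uv (at y within ?E)" for y
  define p where "p = (\<lambda>r t. uv (polar (snd g) r t) \<bullet> (\<i> * cis t))"
  have dec: "smooth_decaying 1 ?E uv" using \<open>uv \<in> divfree_tangent 1 F (snd g)\<close> by (simp add: divfree_tangent_def F)
  then have sm: "smooth_on ?E uv" by (simp add: smooth_decaying_def)
  have Duv: "(uv has_derivative D y) (at y within ?E)" if "y \<in> ?E" for y
    unfolding D_def by (rule smooth_on_has_derivative[OF sm that])
  have \<alpha>_eq: "\<alpha> x v = uv x \<bullet> v" if "x \<in> ?E" for x v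
    using \<open>\<forall>x\<in>F. \<alpha> x = flat uv x\<close> that by (simp add: F flat_def)
  have star: "wedge11 (d0 F \<Phi>1) (d0 F \<Phi>2) x 1 \<i> = J / norm (x - snd g) ^ 4" if "x \<in> ?E" for x
  proof -
    have "d0 F \<Phi>1 x = (\<lambda>v. dipole_velocity (snd g) R (snd gd1) x \<bullet> v)"
      "d0 F \<Phi>2 x = (\<lambda>v. dipole_velocity (snd g) R (snd gd2) x \<bullet> v)"
      using neumann_solution_derivative(1)[OF R q \<open>neumann_solution R ?q gd1 \<Phi>1\<close>, unfolded fst_conv snd_conv, OF that]
        neumann_solution_derivative(1)[OF R q \<open>neumann_solution R ?q gd2 \<Phi>2\<close>, unfolded fst_conv snd_conv, OF that]
      by (auto simp: d0_def F fun_eq_iff)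
    then have "wedge11 (d0 F \<Phi>1) (d0 F \<Phi>2) x 1 \<i> = 
        area_form (dipole_velocity (snd g) R (snd gd1) x) (dipole_velocity (snd g) R (snd gd2) x)"
      by (simp add: wedge11_def area_form_def inner_complex_def)
    then show ?thesis unfolding area_form_dipole_velocity J_def .
  qed
  have curl: "d1 F \<alpha> x 1 \<i> = Im (D x 1) - Re (D x \<i>)" if x: "x \<in> ?E" for x
  proof -
    have "frechet_derivative (\<lambda>y. \<alpha> y v) (at x within ?E) = (\<lambda>h. D x h \<bullet> v)" for v
    proof (rule frechet_derivative_exterior[OF x])
      show "((\<lambda>y. \<alpha> y v) has_derivative (\<lambda>h. D x h \<bullet> v)) (at x within ?E)"
        by (rule has_derivative_transform[OF x \<alpha>_eq has_derivative_inner_left[OF Duv[OF x]]])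
    qed
    then show ?thesis by (simp add: d1_def F inner_complex_def)
  qed
  obtain B0 where B0: "\<And>y. y \<in> ?E \<Longrightarrow> norm (uv y) \<le> B0"
    using smooth_decaying_bounded[OF dec, of "[]"] by auto
  obtain B1 where B1: "\<And>y. y \<in> ?E \<Longrightarrow> norm (D y 1) \<le> B1"
    using smooth_decaying_bounded[OF dec, of "[1]"] by (auto simp: D_def)
  obtain B2 where B2: "\<And>y. y \<in> ?E \<Longrightarrow> norm (D y \<i>) \<le> B2"
    using smooth_decaying_bounded[OF dec, of "[\<i>]"] by (auto simp: D_def)
  define B where "B = max B0 (max B1 B2)"
  have B: "norm (uv y) \<le> B" "norm (D y 1) \<le> B" "norm (D y \<i>) \<le> B" if "y \<in> ?E" for y
    using B0[OF that] B1[OF that] B2[OF that] unfolding B_def by linarith+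
  have contD: "continuous_on ?E (\<lambda>y. D y v)" for v
    unfolding D_def by (rule smooth_on_continuous_deriv[OF sm])
  have Duv': "(uv has_derivative (\<lambda>h. Re h *\<^sub>R D y 1 + Im h *\<^sub>R D y \<i>)) (at y within ?E)" if "y \<in> ?E" for y
    by (rule has_derivative_eq_rhs[OF Duv[OF that]], rule ext,
        rule linear_complex_components[OF has_derivative_linear[OF Duv[OF that]]])
  have stokes: "(LINT y:?E|lborel. (Im (D y 1) - Re (D y \<i>)) * (k / norm (y - snd g) ^ 4)) =
      strip_integral R (\<lambda>r t. 4 * k * p r t / r ^ 4) - k / R ^ 3 * integral {0..2*pi} (p R)"
    "strip_dominated R (\<lambda>r t. 4 * k * p r t / r ^ 4)" for k
    unfolding p_def by (rule weighted_stokes_exterior[OF R Duv' contD contD B]; assumption)+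
  have "L2_form2 F (d1 F \<alpha>) (wedge11 (d0 F \<Phi>1) (d0 F \<Phi>2)) =
      (LINT y:?E|lborel. (Im (D y 1) - Re (D y \<i>)) * (J / norm (y - snd g) ^ 4))"
    unfolding L2_form2_def F
    by (rule set_lebesgue_integral_cong) (simp_all add: curl[unfolded F] star[unfolded F])
  also note stokes(1)
  finally have L2: "L2_form2 F (d1 F \<alpha>) (wedge11 (d0 F \<Phi>1) (d0 F \<Phi>2)) =
      strip_integral R (\<lambda>r t. 4 * J * p r t / r ^ 4) - J / R ^ 3 * integral {0..2*pi} (p R)" .
  obtain b where b: "fst g = cis b" "0 \<le> b" "b \<le> 2 * pi"
  proof -
    obtain b' where b': "fst g = cis b'" using geo(5) by blast
    show thesis
      by (rule that[of "Arg2pi (cis b')"])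
         (use Arg2pi_eq[of "cis b'"] b' in \<open>auto simp: cis_conv_exp Arg2pi_ge_0 less_imp_le[OF Arg2pi_lt_2pi]\<close>)
  qed
  have "boundary_integral R ?q (wedge10 \<alpha> (hodge_star2 (wedge11 (d0 F \<Phi>1) (d0 F \<Phi>2))))
     = - (J / R ^ 4) * R * integral {0..2*pi} (\<lambda>t. uv (polar (snd (fst ?q)) R t) \<bullet> (\<i> * cis t))"
  proof (rule boundary_integral_polar[OF R])
    show "fst (fst ?q) = cis b" "0 \<le> b" "b \<le> 2 * pi" using b by simp_all
    have sub: "sphere (snd (fst ?q)) R \<subseteq> ?E" by (auto simp: exterior_def dist_norm norm_minus_commute)
    show "continuous_on (sphere (snd (fst ?q)) R) uv"
      by (rule continuous_on_subset[OF smooth_on_continuous[OF sm] sub])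
    show "wedge10 \<alpha> (hodge_star2 (wedge11 (d0 F \<Phi>1) (d0 F \<Phi>2))) x v = J / R ^ 4 * (uv x \<bullet> v)"
      if "x \<in> sphere (snd (fst ?q)) R" for x v
    proof -
      have x: "x \<in> ?E" "norm (x - snd g) = R"
        using that sub by (auto simp: dist_norm norm_minus_commute)
      show ?thesis by (simp add: wedge10_def hodge_star2_def star[OF x(1)] \<alpha>_eq[OF x(1)] x(2))
    qed
  qed
  also have "\<dots> = - J / R ^ 3 * integral {0..2*pi} (p R)"
    using R by (simp add: p_def eval_nat_numeral)
  finally have bdry: "boundary_integral R ?q (wedge10 \<alpha> (hodge_star2 (wedge11 (d0 F \<Phi>1) (d0 F \<Phi>2))))
     = - J / R ^ 3 * integral {0..2*pi} (p R)" .
  define \<gamma> where "\<gamma> = (SOME \<gamma>. \<gamma> \<in> \<mu>)"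
  have "\<gamma> \<in> \<mu>"
  proof -
    obtain \<gamma>0 where \<gamma>0: "\<gamma>0 \<in> one_forms (fluid0 R)" "\<mu> = form_class R \<gamma>0"
      using \<open>\<mu> \<in> Xvol_dual R\<close> by (auto simp: Xvol_dual_def)
    have "smooth_on ?S (\<lambda>x. 0 :: real)"
      by (rule smooth_on_Re_inverse_power[OF R, of _ _ 0 0]) simp
    moreover have "d0 ?S (\<lambda>x. 0) x v = 0" if "x \<in> ?S" for x v
      unfolding d0_def frechet_derivative_exterior[OF that has_derivative_const] ..
    ultimately have "\<gamma>0 \<in> \<mu>"
      using \<gamma>0 unfolding form_class_def fluid0_eq[OF R] by (auto intro!: exI[of _ "\<lambda>x. 0"])
    then show ?thesis unfolding \<gamma>_def by (rule someI[of "\<lambda>\<gamma>. \<gamma> \<in> \<mu>"])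
  qed
  then obtain f where \<gamma>: "\<gamma> \<in> one_forms ?S" and f: "smooth_on ?S f"
    and \<gamma>_eq: "\<And>x v. x \<in> ?S \<Longrightarrow> \<gamma> x v = pullback_form R \<phi> \<alpha> x v + d0 ?S f x v"
    unfolding \<open>\<mu> = form_class R (pullback_form R \<phi> \<alpha>)\<close> form_class_def fluid0_eq[OF R] by blast
  have "(LINT x:?S|lborel. \<gamma> x (w x)) = strip_integral R (\<lambda>r t. 4 * J * p r t / r ^ 4)"
  proof -
    have "\<gamma> x v = uv (\<phi> x) \<bullet> frechet_derivative \<phi> (at x within ?S) v + frechet_derivative f (at x within ?S) v"
      if "x \<in> ?S" for x v
    proof -
      have "\<phi> x \<in> ?E" using geo(3) that by blast
      then show ?thesis unfolding \<gamma>_eq[OF that] by (simp add: pullback_form_def d0_def fluid0_eq[OF R] \<alpha>_eq)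
    qed
    moreover have "frechet_derivative \<phi> (at x within ?S) (w x) = swirl (snd g) J (\<phi> x)" if "x \<in> ?S" for x
      using neumann_curvature_swirl[OF R q \<open>is_neumann_curvature R ?q _ _ w\<close> that] by (simp add: J_def)
    ultimately show ?thesis
      using swirl_pairing[OF R q \<gamma> f, of uv w J] stokes(2)[of J] stokes(2)[of "- J"] unfolding p_def by simp
  qed
  then have "dual_pairing R \<mu> w = strip_integral R (\<lambda>r t. 4 * J * p r t / r ^ 4)"
    unfolding dual_pairing_def Let_def \<gamma>_def[symmetric] fluid0_eq[OF R] .
  then show ?thesis unfolding L2 bdry by simp
qed

end
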